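(* Let $(A,\cdot,\circ,P,Q)$ be a relative PCA algebra. If $r\in A\otimes A$ is an antisymmetric solution of the relative PCA Yang-Baxter equation (RPCA-YBE) in $(A,\cdot,\circ,P,Q)$, then $(A,\cdot,\circ,\Delta,\theta,P,Q)$ is a relative PCA bialgebra, where $\Delta,\theta:A\rightarrow A\otimes A$ are the linear maps defined by $$\Delta(x)=\big(\mathrm{id}\otimes\mathcal{L}_{\cdot}(x)-\mathcal{L}_{\cdot}(x)\otimes\mathrm{id}\big)r,\qquad \theta(x)=\big(\mathcal{L}_{\circ}(x)\otimes\mathrm{id}-\mathrm{id}\otimes\mathrm{ad}(x)\big)r,\qquad\forall x\in A.$$
   Context: All vector spaces are finite-dimensional over an algebraically closed field $\mathbb K$ of characteristic zero. $\mathcal{L}_{\diamond}(x)y=x\diamond y$, $\mathcal{R}_{\diamond}(x)y=y\diamond x$, $\mathrm{ad}(x)y=[x,y]=x\circ y-y\circ x$; $\tau(x\otimes y)=y\otimes x$, $\xi(x\otimes y\otimes z)=y\otimes z\otimes x$. $r$ is antisymmetric if $\tau(r)=-r$. RPCA-YBE: for $r=\sum_i a_i\otimes b_i\in A\otimes A$ put $\mathbf{A}(r)=\sum_{i,j}\big(a_i\cdot a_j\otimes b_i\otimes b_j-a_i\otimes a_j\cdot b_i\otimes b_j+a_i\otimes a_j\otimes b_i\cdot b_j\big)$, $\mathbf{T}(r)=\sum_{i,j}\big(a_i\circ a_j\otimes b_i\otimes b_j+a_i\otimes b_i\circ a_j\otimes b_j-a_i\otimes a_j\otimes[b_i,b_j]\big)$.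 $r$ is a solution of the RPCA-YBE in $(A,\cdot,\circ,P,Q)$ if $\mathbf{A}(r)=\mathbf{T}(r)=0$, $(Q\otimes\mathrm{id}-\mathrm{id}\otimes P)r=0$ and $(P\otimes\mathrm{id}-\mathrm{id}\otimes Q)r=0$. Relative Poisson algebra: $(A,\cdot,[-,-],P)$ with $(A,\cdot)$ commutative associative, $(A,[-,-])$ a Lie algebra, $P$ a derivation of both, and $[z,x\cdot y]=[z,x]\cdot y+x\cdot[z,y]+x\cdot y\cdot P(z)$. Anti-pre-Lie algebra: $(A,\circ)$ such that, with $[x,y]=x\circ y-y\circ x$, $x\circ(y\circ z)-y\circ(x\circ z)=[y,x]\circ z$ and $[x,y]\circ z+[y,z]\circ x+[z,x]\circ y=0$; $(A,[-,-])$ is then a Lie algebra (the sub-adjacent Lie algebra). Relative PCA algebra: $(A,\cdot,\circ,P,Q)$ with $(A,\cdot)$ commutative associative, $(A,\circ)$ anti-pre-Lie with sub-adjacent Lie algebra $(A,[-,-])$, $P,Q:A\to A$ linear, $(A,\cdot,[-,-],P)$ a relative Poisson algebra, and: $x\cdot Q(y)-P(x)\cdot y-Q(x\cdot y)=0$; $x\circ Q(y)-P(x)\circ y-Q(x\circ y)=0$; $x\cdot(y\circ z)-y\circ(x\cdot z)+[x,y]\cdot z-x\cdot P(y)\cdot z=0$; $(x\cdot y)\circ z-y\circ(x\cdot z)-x\circ(y\cdot z)+Q(x\cdot y\cdot z)=0$ for all $x,y,z$. Relative PCA coalgebra: $(A,\Delta,\theta,Q,P)$ with $\tau\Delta=\Delta$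 and $(\mathrm{id}\otimes\Delta)\Delta=(\Delta\otimes\mathrm{id})\Delta$ (cocommutative coassociative); $(A,\theta)$ an anti-pre-Lie coalgebra, i.e. $(\mathrm{id}^{\otimes 3}-\tau\otimes\mathrm{id})(\mathrm{id}\otimes\theta)\theta=(\tau\otimes\mathrm{id}-\mathrm{id}^{\otimes 3})(\theta\otimes\mathrm{id})\theta$ and $(\mathrm{id}^{\otimes 3}+\xi+\xi^{2})(\tau\otimes\mathrm{id}-\mathrm{id}^{\otimes 3})(\theta\otimes\mathrm{id})\theta=0$; $Q,P$ linear; and with $\delta=\theta-\tau\theta$, for all $x$: $\Delta Q=(Q\otimes\mathrm{id}+\mathrm{id}\otimes Q)\Delta$; $\delta Q=(Q\otimes\mathrm{id}+\mathrm{id}\otimes Q)\delta$; $(\mathrm{id}\otimes\Delta)\delta(x)-(\delta\otimes\mathrm{id})\Delta(x)-(\tau\otimes\mathrm{id})(\mathrm{id}\otimes\delta)\Delta(x)-(Q\otimes\mathrm{id}\otimes\mathrm{id})(\Delta\otimes\mathrm{id})\Delta(x)=0$; $\Delta P=(\mathrm{id}\otimes P-Q\otimes\mathrm{id})\Delta$; $\theta P=(\mathrm{id}\otimes P-Q\otimes\mathrm{id})\theta$; $(\mathrm{id}\otimes\theta)\Delta(x)-(\tau\otimes\mathrm{id})(\mathrm{id}\otimes\Delta)\theta(x)+(\delta\otimes\mathrm{id})\Delta(x)-(\mathrm{id}\otimes Q\otimes\mathrm{id})(\Delta\otimes\mathrm{id})\Delta(x)=0$; $(\Delta\otimes\mathrm{id})\theta(x)=(\tau\otimes\mathrm{id})(\mathrm{id}\otimes\Delta)\theta(x)+(\mathrm{id}\otimes\Delta)\theta(x)-(\Delta\otimes\mathrm{id})\Delta(P(x))$.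 Relative PCA bialgebra: $(A,\cdot,\circ,\Delta,\theta,P,Q)$ such that $(A,\cdot,\circ,P,Q)$ is a relative PCA algebra, $(A,\Delta,\theta,Q,P)$ is a relative PCA coalgebra, and for all $x,y\in A$ (with $\delta=\theta-\tau\theta$): (a) $\Delta(x\cdot y)=(\mathcal{L}_{\cdot}(x)\otimes\mathrm{id})\Delta(y)+(\mathrm{id}\otimes\mathcal{L}_{\cdot}(y))\Delta(x)$; (b) $(\mathrm{id}^{\otimes 2}-\tau)\big(\theta(x\circ y)-(\mathcal{L}_{\circ}(x)\otimes\mathrm{id})\theta(y)-(\mathrm{id}\otimes\mathcal{L}_{\circ}(x))\theta(y)+(\mathrm{id}\otimes\mathcal{R}_{\circ}(y))\theta(x)\big)=0$ and $\theta([x,y])=(\mathrm{id}\otimes\mathrm{ad}(x)-\mathcal{L}_{\circ}(x)\otimes\mathrm{id})\theta(y)-(\mathrm{id}\otimes\mathrm{ad}(y)-\mathcal{L}_{\circ}(y)\otimes\mathrm{id})\theta(x)$; (c) $\theta(x\cdot y)+(\mathcal{L}_{\circ}(y)\otimes\mathrm{id})\Delta(x)-(\mathrm{id}\otimes\mathcal{L}_{\cdot}(x))\theta(y)+(\mathcal{L}_{\circ}(x)\otimes\mathrm{id})\Delta(y)-(\mathrm{id}\otimes\mathcal{L}_{\cdot}(y))\theta(x)-(Q\otimes\mathrm{id})\Delta(x\cdot y)=0$; (d) $\Delta(x\circ y)+(\tau+\mathrm{id}^{\otimes 2})(\mathrm{id}\otimes\mathcal{L}_{\cdot}(y))\theta(x)-(\mathrm{id}\otimes\mathcal{L}_{\circ}(x)+\mathcal{L}_{\circ}(x)\otimes\mathrm{id})\Delta(y)-\Delta(P(x)\cdot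 y)=0$; (e) $(\mathcal{L}_{\cdot}(x)\otimes\mathrm{id}-\mathrm{id}\otimes\mathcal{L}_{\cdot}(x))\theta(y)+(\mathcal{L}_{\circ}(y)\otimes\mathrm{id}-\mathrm{id}\otimes\mathrm{ad}(y))\Delta(x)-\Delta([x,y])+\Delta(x\cdot P(y))=0$; (f) $(\mathrm{id}\otimes\mathcal{R}_{\circ}(y))\Delta(x)+(\mathcal{L}_{\cdot}(x)\otimes\mathrm{id})\delta(y)-(\mathrm{id}\otimes\mathcal{L}_{\circ}(x))\Delta(y)+\tau(\mathrm{id}\otimes\mathcal{L}_{\cdot}(y))\theta(x)-\delta(x\cdot y)+(\mathrm{id}\otimes Q)\Delta(x\cdot y)=0$. *)

theory Defs
  imports
    "HOL-Computational_Algebra.Polynomial"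
    "HOL-Library.Function_Algebras"
begin

section \<open>Tensor powers of a vector space\<close>

text \<open>
  For a vector space \<open>A\<close> over \<open>K\<close>, the tensor product \<open>A \<otimes> A\<close> is realised inside the space of
  \<open>K\<close>-valued functions on the bilinear forms of \<open>A\<close>: the pure tensor \<open>x \<otimes> y\<close> is evaluation
  of bilinear forms at \<open>(x, y)\<close>, and \<open>A \<otimes> A\<close> is the span of the pure tensors. Since HOL
  functions are total, a tensor is extended by \<open>0\<close> to those functions of type
  \<open>'a \<Rightarrow> 'a \<Rightarrow> 'k\<close> that are not bilinear, so that equality of tensors is plain equality.
  \<open>A \<otimes> A \<otimes> A\<close> is obtained in the same way from trilinear forms. That these spaces have the universal
  property of the tensor product is proved below
  (\<open>tensor2_universal\<close>, \<open>tensor3_universal\<close>). Sums and differences of tensors are the pointwise ones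
  of \<open>Function_Algebras\<close>.
\<close>

type_synonym ('a, 'k) tensor2 = "('a \<Rightarrow> 'a \<Rightarrow> 'k) \<Rightarrow> 'k"
type_synonym ('a, 'k) tensor3 = "('a \<Rightarrow> 'a \<Rightarrow> 'a \<Rightarrow> 'k) \<Rightarrow> 'k"

definition fscale :: "'k::times \<Rightarrow> ('f \<Rightarrow> 'k) \<Rightarrow> 'f \<Rightarrow> 'k"
  where "fscale c t = (\<lambda>\<beta>. c * t \<beta>)"

definition bilinear_map ::
  "('k::field \<Rightarrow> 'a::ab_group_add \<Rightarrow> 'a) \<Rightarrow> ('k \<Rightarrow> 'w::ab_group_add \<Rightarrow> 'w) \<Rightarrow> ('a \<Rightarrow> 'a \<Rightarrow> 'w) \<Rightarrow> bool"
  where "bilinear_map s s' \<phi> \<longleftrightarrow>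
    (\<forall>x. Vector_Spaces.linear s s' (\<lambda>y. \<phi> x y)) \<and>
    (\<forall>y. Vector_Spaces.linear s s' (\<lambda>x. \<phi> x y))"

definition trilinear_map ::
  "('k::field \<Rightarrow> 'a::ab_group_add \<Rightarrow> 'a) \<Rightarrow> ('k \<Rightarrow> 'w::ab_group_add \<Rightarrow> 'w) \<Rightarrow> ('a \<Rightarrow> 'a \<Rightarrow> 'a \<Rightarrow> 'w) \<Rightarrow> bool"
  where "trilinear_map s s' \<phi> \<longleftrightarrow>
    (\<forall>x y. Vector_Spaces.linear s s' (\<lambda>z. \<phi> x y z)) \<and>
    (\<forall>x z. Vector_Spaces.linear s s' (\<lambda>y. \<phi> x y z)) \<and>
    (\<forall>y z. Vector_Spaces.linear s s' (\<lambda>x. \<phi> x y z))"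

text \<open>
  The linear extension to tensors of a multilinear map \<open>\<phi>\<close> with values in a space of \<open>K\<close>-valued
  functions (such as the tensor powers themselves): \<open>\<Sum>\<^sub>i a\<^sub>i \<otimes> b\<^sub>i\<close> is sent to
  \<open>\<Sum>\<^sub>i \<phi> a\<^sub>i b\<^sub>i\<close>; see \<open>ext2_sum_pure2\<close>, \<open>ext3_sum_pure3\<close>.
\<close>

definition ext2 :: "('a \<Rightarrow> 'a \<Rightarrow> 'f \<Rightarrow> 'k) \<Rightarrow> ('a, 'k) tensor2 \<Rightarrow> 'f \<Rightarrow> 'k"
  where "ext2 \<phi> t = (\<lambda>\<gamma>. t (\<lambda>x y. \<phi> x y \<gamma>))"

definition ext3 :: "('a \<Rightarrow> 'a \<Rightarrow> 'a \<Rightarrow> 'f \<Rightarrow> 'k) \<Rightarrow> ('a, 'k) tensor3 \<Rightarrow> 'f \<Rightarrow> 'k"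
  where "ext3 \<phi> t = (\<lambda>\<gamma>. t (\<lambda>x y z. \<phi> x y z \<gamma>))"

text \<open>A separate name for \<open>vector_space\<close>, so that the notions below are not also generated for
  the instances of \<open>vector_space\<close> in the library.\<close>

locale tensor_powers = vector_space scale
  for scale :: "'a::field \<Rightarrow> 'b::ab_group_add \<Rightarrow> 'b"
begin

definition pure2 :: "'b \<Rightarrow> 'b \<Rightarrow> ('b, 'a) tensor2"
  where "pure2 x y = (\<lambda>\<beta>. if bilinear_map scale (*) \<beta> then \<beta> x y else 0)"

definition pure3 :: "'b \<Rightarrow> 'b \<Rightarrow> 'b \<Rightarrow> ('b, 'a) tensor3"
  where "pure3 x y z = (\<lambda>\<gamma>. if trilinear_map scale (*) \<gamma> then \<gamma> x y z else 0)"

definition Tensor2 :: "('b, 'a) tensor2 set"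
  where "Tensor2 = module.span fscale {pure2 x y |x y. True}"

definition Tensor3 :: "('b, 'a) tensor3 set"
  where "Tensor3 = module.span fscale {pure3 x y z |x y z. True}"

text \<open>\<open>tmap2 f g\<close> is \<open>f \<otimes> g\<close>, \<open>flip2\<close> is \<open>\<tau>\<close>, \<open>flip3\<close> is \<open>\<tau> \<otimes> id\<close>, \<open>rot3\<close> is \<open>\<xi>\<close>.\<close>

definition tmap2 :: "('b \<Rightarrow> 'b) \<Rightarrow> ('b \<Rightarrow> 'b) \<Rightarrow> ('b, 'a) tensor2 \<Rightarrow> ('b, 'a) tensor2"
  where "tmap2 f g = ext2 (\<lambda>x y. pure2 (f x) (g y))"

definition tmap3 :: "('b \<Rightarrow> 'b) \<Rightarrow> ('b \<Rightarrow> 'b) \<Rightarrow> ('b \<Rightarrow> 'b) \<Rightarrow> ('b, 'a) tensor3 \<Rightarrow> ('b, 'a) tensor3"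
  where "tmap3 f g h = ext3 (\<lambda>x y z. pure3 (f x) (g y) (h z))"

definition flip2 :: "('b, 'a) tensor2 \<Rightarrow> ('b, 'a) tensor2"
  where "flip2 = ext2 (\<lambda>x y. pure2 y x)"

definition flip3 :: "('b, 'a) tensor3 \<Rightarrow> ('b, 'a) tensor3"
  where "flip3 = ext3 (\<lambda>x y z. pure3 y x z)"

definition rot3 :: "('b, 'a) tensor3 \<Rightarrow> ('b, 'a) tensor3"
  where "rot3 = ext3 (\<lambda>x y z. pure3 y z x)"

text \<open>\<open>co_left d\<close> is \<open>d \<otimes> id\<close> and \<open>co_right d\<close> is \<open>id \<otimes> d\<close>, both from \<open>A \<otimes> A\<close> to
  \<open>A \<otimes> A \<otimes> A\<close>, for a linear map \<open>d\<close> from \<open>A\<close> to \<open>A \<otimes> A\<close>.\<close>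

definition co_left :: "('b \<Rightarrow> ('b, 'a) tensor2) \<Rightarrow> ('b, 'a) tensor2 \<Rightarrow> ('b, 'a) tensor3"
  where "co_left d = ext2 (\<lambda>x y. ext2 (\<lambda>p q. pure3 p q y) (d x))"

definition co_right :: "('b \<Rightarrow> ('b, 'a) tensor2) \<Rightarrow> ('b, 'a) tensor2 \<Rightarrow> ('b, 'a) tensor3"
  where "co_right d = ext2 (\<lambda>x y. ext2 (\<lambda>p q. pure3 x p q) (d y))"

definition cocommutator :: "('b \<Rightarrow> ('b, 'a) tensor2) \<Rightarrow> 'b \<Rightarrow> ('b, 'a) tensor2"
  where "cocommutator \<theta> x = \<theta> x - flip2 (\<theta> x)"

end


subsection \<open>Correctness of the construction\<close>

lemma vector_space_fscale: "vector_space (fscale :: 'k::field \<Rightarrow> ('f \<Rightarrow> 'k) \<Rightarrow> 'f \<Rightarrow> 'k)"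
  by unfold_locales (auto simp: fscale_def fun_eq_iff algebra_simps)

lemma vector_space_mult: "vector_space ((*) :: 'k::field \<Rightarrow> 'k \<Rightarrow> 'k)"
  by unfold_locales (auto simp: algebra_simps)

lemma linearI_vector_space:
  assumes "vector_space s" "vector_space s'"
    and "\<And>x y. f (x + y) = f x + f y" and "\<And>c x. f (s c x) = s' c (f x)"
  shows "Vector_Spaces.linear s s' f"
  using assms unfolding Vector_Spaces.linear_def module_hom_def module_hom_axioms_def
  by (simp add: module_iff_vector_space)

lemma linear_add_scale:
  assumes "Vector_Spaces.linear s s' f"
  shows "f (x + y) = f x + f y" and "f (s c x) = s' c (f x)"
  using assms module_hom.add[of s s' f] module_hom.scale[of s s' f]
  unfolding Vector_Spaces.linear_def by blast+

lemma linear_eval: "Vector_Spaces.linear fscale (*) (\<lambda>t :: 'f \<Rightarrow> 'k::field. t \<gamma>)"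
  by (intro linearI_vector_space vector_space_fscale vector_space_mult) (auto simp: fscale_def)

lemma linear_compose_form:
  assumes "Vector_Spaces.linear s' s'' g" and "Vector_Spaces.linear s s' f"
  shows "Vector_Spaces.linear s s'' (\<lambda>x. g (f x))"
  using Vector_Spaces.linear_compose[OF assms(2,1)] by (simp add: o_def)

lemma bilinear_map_compose:
  assumes "Vector_Spaces.linear s' s'' g" and "bilinear_map s s' \<phi>"
  shows "bilinear_map s s'' (\<lambda>x y. g (\<phi> x y))"
proof -
  note [simp] = bilinear_map_def
  have "Vector_Spaces.linear s s'' (\<lambda>y. g (\<phi> x y))" for x
    by (rule linear_compose_form[OF assms(1)]) (use assms(2) in simp)
  moreover have "Vector_Spaces.linear s s'' (\<lambda>x. g (\<phi> x y))" for y
    by (rule linear_compose_form[OF assms(1)]) (use assms(2) in simp)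
  ultimately show ?thesis by simp
qed

lemma trilinear_map_compose:
  assumes "Vector_Spaces.linear s' s'' g" and "trilinear_map s s' \<phi>"
  shows "trilinear_map s s'' (\<lambda>x y z. g (\<phi> x y z))"
proof -
  note [simp] = trilinear_map_def
  have "Vector_Spaces.linear s s'' (\<lambda>z. g (\<phi> x y z))" for x y
    by (rule linear_compose_form[OF assms(1)]) (use assms(2) in simp)
  moreover have "Vector_Spaces.linear s s'' (\<lambda>y. g (\<phi> x y z))" for x z
    by (rule linear_compose_form[OF assms(1)]) (use assms(2) in simp)
  moreover have "Vector_Spaces.linear s s'' (\<lambda>x. g (\<phi> x y z))" for y z
    by (rule linear_compose_form[OF assms(1)]) (use assms(2) in simp)
  ultimately show ?thesis by simp
qed

lemma sum_fun_apply: "(\<Sum>i\<in>I. t i) \<gamma> = (\<Sum>i\<in>I. t i \<gamma>)"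
  for t :: "'i \<Rightarrow> 'f \<Rightarrow> 'k::comm_monoid_add"
  by (induction I rule: infinite_finite_induct) auto

context tensor_powers
begin

lemma ext2_sum_pure2:
  assumes "bilinear_map scale fscale \<phi>"
  shows "ext2 \<phi> (\<Sum>i\<in>I. pure2 (u i) (v i)) = (\<Sum>i\<in>I. \<phi> (u i) (v i))"
proof -
  have "bilinear_map scale (*) (\<lambda>x y. \<phi> x y \<gamma>)" for \<gamma>
    using linear_eval assms by (rule bilinear_map_compose)
  then show ?thesis
    by (simp add: ext2_def fun_eq_iff sum_fun_apply pure2_def)
qed

lemma ext3_sum_pure3:
  assumes "trilinear_map scale fscale \<phi>"
  shows "ext3 \<phi> (\<Sum>i\<in>I. pure3 (u i) (v i) (w i)) = (\<Sum>i\<in>I. \<phi> (u i) (v i) (w i))"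
proof -
  have "trilinear_map scale (*) (\<lambda>x y z. \<phi> x y z \<gamma>)" for \<gamma>
    using linear_eval assms by (rule trilinear_map_compose)
  then show ?thesis
    by (simp add: ext3_def fun_eq_iff sum_fun_apply pure3_def)
qed

end

lemma linear_factor:
  fixes s :: "'k::field \<Rightarrow> 'v::ab_group_add \<Rightarrow> 'v" and s' :: "'k \<Rightarrow> 'w::ab_group_add \<Rightarrow> 'w"
  assumes s: "vector_space s" and s': "vector_space s'"
    and dep: "\<And>X c. finite X \<Longrightarrow> (\<Sum>x\<in>X. s (c x) (p x)) = 0 \<Longrightarrow> (\<Sum>x\<in>X. s' (c x) (\<phi> x)) = 0"
  shows "\<exists>f. Vector_Spaces.linear s s' f \<and> (\<forall>x. f (p x) = \<phi> x)"
proof -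
  interpret vector_space_pair s s' using s s' by (rule vector_space_pair.intro)
  obtain B where B: "B \<subseteq> range p" "vs1.independent B" "range p \<subseteq> vs1.span B"
    using vs1.maximal_independent_subset[of "range p"] by blast
  define q where "q = inv_into UNIV p"
  have pq: "p (q b) = b" if "b \<in> B" for b
    using B(1) that unfolding q_def by (meson f_inv_into_f subsetD)
  obtain f where f: "Vector_Spaces.linear s s' f" and fB: "\<And>b. b \<in> B \<Longrightarrow> f b = \<phi> (q b)"
    using linear_independent_extend[OF B(2), of "\<lambda>b. \<phi> (q b)"] by blast
  interpret f: Vector_Spaces.linear s s' f by (fact f)
  have "f (p x) = \<phi> x" for x
  proof -
    obtain t r where t: "finite t" "t \<subseteq> B" and px: "p x = (\<Sum>b\<in>t. s (r b) b)"
      using B(3) unfolding vs1.span_explicit by blast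
    have inj: "inj_on q t" by (metis inj_onI pq subsetD t(2))
    show ?thesis
    proof (cases "x \<in> q ` t")
      case True
      then show ?thesis using fB pq t(2) by auto
    next
      case False
      define c where "c y = (if y = x then - 1 else r (p y))" for y
      have cq: "c (q b) = r b" if "b \<in> t" for b
        using False that pq t(2) by (auto simp: c_def)
      have cx: "c x = - 1" by (simp add: c_def)
      have split: "(\<Sum>y\<in>insert x (q ` t). g y) = g x + (\<Sum>b\<in>t. g (q b))"
        for g :: "_ \<Rightarrow> 'z::comm_monoid_add"
        using False t(1) inj by (simp add: sum.reindex)
      have "(\<Sum>y\<in>insert x (q ` t). s (c y) (p y)) = - p x + (\<Sum>b\<in>t. s (r b) b)"
        unfolding split using t(2) pq by (auto simp: cx cq intro!: sum.cong)
      also have "\<dots> = 0" by (simp add: px)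
      finally have "(\<Sum>y\<in>insert x (q ` t). s' (c y) (\<phi> y)) = 0"
        by (intro dep) (use t(1) in auto)
      then have "(\<Sum>b\<in>t. s' (r b) (\<phi> (q b))) = \<phi> x"
        unfolding split by (simp add: cx cq)
      moreover have "f (p x) = (\<Sum>b\<in>t. s' (r b) (\<phi> (q b)))"
        unfolding px using t(2) fB by (auto simp: f.sum f.scale intro!: sum.cong)
      ultimately show ?thesis by simp
    qed
  qed
  then show ?thesis using f by blast
qed

lemma zero_if_forms_zero:
  fixes s' :: "'k::field \<Rightarrow> 'w::ab_group_add \<Rightarrow> 'w"
  assumes s': "vector_space s'" and zero: "\<And>l. Vector_Spaces.linear s' (*) l \<Longrightarrow> l w = 0"
  shows "w = 0"
proof (rule ccontr)
  assume "w \<noteq> 0"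
  interpret vector_space_pair s' "(*)"
    using s' vector_space_mult by (rule vector_space_pair.intro)
  have "vs1.independent {w}" using \<open>w \<noteq> 0\<close> by simp
  from linear_independent_extend[OF this, of "\<lambda>_. 1"] zero show False by force
qed

context tensor_powers
begin

theorem tensor2_universal:
  fixes s' :: "'a \<Rightarrow> 'w::ab_group_add \<Rightarrow> 'w"
  assumes s': "vector_space s'" and \<phi>: "bilinear_map scale s' \<phi>"
  shows "\<exists>f. Vector_Spaces.linear fscale s' f \<and> (\<forall>x y. f (pure2 x y) = \<phi> x y)"
    and "Vector_Spaces.linear fscale s' f \<Longrightarrow> \<forall>x y. f (pure2 x y) = \<phi> x y \<Longrightarrow>
      Vector_Spaces.linear fscale s' g \<Longrightarrow> \<forall>x y. g (pure2 x y) = \<phi> x y \<Longrightarrow> t \<in> Tensor2 \<Longrightarrow> f t = g t"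
proof -
  have "\<exists>f. Vector_Spaces.linear fscale s' f \<and> (\<forall>x. f (case_prod pure2 x) = case_prod \<phi> x)"
  proof (rule linear_factor[OF vector_space_fscale s'])
    fix X and c :: "'b \<times> 'b \<Rightarrow> 'a"
    assume *: "(\<Sum>x\<in>X. fscale (c x) (case_prod pure2 x)) = 0"
    show "(\<Sum>x\<in>X. s' (c x) (case_prod \<phi> x)) = 0"
    proof (rule zero_if_forms_zero[OF s'])
      fix l assume l: "Vector_Spaces.linear s' (*) l"
      interpret l: Vector_Spaces.linear s' "(*)" l by (fact l)
      have "bilinear_map scale (*) (\<lambda>x y. l (\<phi> x y))"
        using l \<phi> by (rule bilinear_map_compose)
      then have "l (\<Sum>x\<in>X. s' (c x) (case_prod \<phi> x))
          = (\<Sum>x\<in>X. fscale (c x) (case_prod pure2 x)) (\<lambda>x y. l (\<phi> x y))"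
        by (auto simp: l.sum l.scale sum_fun_apply fscale_def pure2_def split_beta)
      then show "l (\<Sum>x\<in>X. s' (c x) (case_prod \<phi> x)) = 0" by (simp add: *)
    qed
  qed
  then show "\<exists>f. Vector_Spaces.linear fscale s' f \<and> (\<forall>x y. f (pure2 x y) = \<phi> x y)" by auto
next
  interpret p: vector_space_pair fscale s' using vector_space_fscale s' by (rule vector_space_pair.intro)
  assume "Vector_Spaces.linear fscale s' f" "\<forall>x y. f (pure2 x y) = \<phi> x y"
    "Vector_Spaces.linear fscale s' g" "\<forall>x y. g (pure2 x y) = \<phi> x y" "t \<in> Tensor2"
  then show "f t = g t"
    unfolding Tensor2_def by (elim p.linear_eq_on) auto
qed

theorem tensor3_universal:
  fixes s' :: "'a \<Rightarrow> 'w::ab_group_add \<Rightarrow> 'w"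
  assumes s': "vector_space s'" and \<phi>: "trilinear_map scale s' \<phi>"
  shows "\<exists>f. Vector_Spaces.linear fscale s' f \<and> (\<forall>x y z. f (pure3 x y z) = \<phi> x y z)"
    and "Vector_Spaces.linear fscale s' f \<Longrightarrow> \<forall>x y z. f (pure3 x y z) = \<phi> x y z \<Longrightarrow>
      Vector_Spaces.linear fscale s' g \<Longrightarrow> \<forall>x y z. g (pure3 x y z) = \<phi> x y z \<Longrightarrow> t \<in> Tensor3 \<Longrightarrow> f t = g t"
proof -
  let ?p = "\<lambda>(x, y, z). pure3 x y z" and ?\<phi> = "\<lambda>(x, y, z). \<phi> x y z"
  have "\<exists>f. Vector_Spaces.linear fscale s' f \<and> (\<forall>x. f (?p x) = ?\<phi> x)"
  proof (rule linear_factor[OF vector_space_fscale s'])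
    fix X and c :: "'b \<times> 'b \<times> 'b \<Rightarrow> 'a"
    assume *: "(\<Sum>x\<in>X. fscale (c x) (?p x)) = 0"
    show "(\<Sum>x\<in>X. s' (c x) (?\<phi> x)) = 0"
    proof (rule zero_if_forms_zero[OF s'])
      fix l assume l: "Vector_Spaces.linear s' (*) l"
      interpret l: Vector_Spaces.linear s' "(*)" l by (fact l)
      have "trilinear_map scale (*) (\<lambda>x y z. l (\<phi> x y z))"
        using l \<phi> by (rule trilinear_map_compose)
      then have "l (\<Sum>x\<in>X. s' (c x) (?\<phi> x))
          = (\<Sum>x\<in>X. fscale (c x) (?p x)) (\<lambda>x y z. l (\<phi> x y z))"
        by (auto simp: l.sum l.scale sum_fun_apply fscale_def pure3_def split_beta)
      then show "l (\<Sum>x\<in>X. s' (c x) (?\<phi> x)) = 0" by (simp add: *)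
    qed
  qed
  then show "\<exists>f. Vector_Spaces.linear fscale s' f \<and> (\<forall>x y z. f (pure3 x y z) = \<phi> x y z)" by auto
next
  interpret p: vector_space_pair fscale s' using vector_space_fscale s' by (rule vector_space_pair.intro)
  assume "Vector_Spaces.linear fscale s' f" "\<forall>x y z. f (pure3 x y z) = \<phi> x y z"
    "Vector_Spaces.linear fscale s' g" "\<forall>x y z. g (pure3 x y z) = \<phi> x y z" "t \<in> Tensor3"
  then show "f t = g t"
    unfolding Tensor3_def by (elim p.linear_eq_on) auto
qed

lemma bilinear_pure2: "bilinear_map scale fscale pure2"
proof -
  have "\<beta> x (y + y') = \<beta> x y + \<beta> x y'" "\<beta> x (scale c y) = c * \<beta> x y"
    "\<beta> (x + x') y = \<beta> x y + \<beta> x' y" "\<beta> (scale c x) y = c * \<beta> x y"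
    if "bilinear_map scale (*) \<beta>" for \<beta> :: "'b \<Rightarrow> 'b \<Rightarrow> 'a" and x x' y y' c
    using that linear_add_scale[of scale "(*)" "\<lambda>y. \<beta> x y"] linear_add_scale[of scale "(*)" "\<lambda>x. \<beta> x y"]
    unfolding bilinear_map_def by simp_all
  then show ?thesis
    unfolding bilinear_map_def[of _ fscale]
    by (intro conjI allI linearI_vector_space vector_space_fscale vector_space_axioms)
      (simp_all add: pure2_def fscale_def fun_eq_iff)
qed

lemma trilinear_pure3: "trilinear_map scale fscale pure3"
proof -
  have "\<gamma> x y (z + z') = \<gamma> x y z + \<gamma> x y z'" "\<gamma> x y (scale c z) = c * \<gamma> x y z"
    "\<gamma> x (y + y') z = \<gamma> x y z + \<gamma> x y' z" "\<gamma> x (scale c y) z = c * \<gamma> x y z"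
    "\<gamma> (x + x') y z = \<gamma> x y z + \<gamma> x' y z" "\<gamma> (scale c x) y z = c * \<gamma> x y z"
    if "trilinear_map scale (*) \<gamma>" for \<gamma> :: "'b \<Rightarrow> 'b \<Rightarrow> 'b \<Rightarrow> 'a" and x x' y y' z z' c
    using that linear_add_scale[of scale "(*)" "\<lambda>z. \<gamma> x y z"]
      linear_add_scale[of scale "(*)" "\<lambda>y. \<gamma> x y z"] linear_add_scale[of scale "(*)" "\<lambda>x. \<gamma> x y z"]
    unfolding trilinear_map_def by simp_all
  note * = this
  show ?thesis
    unfolding trilinear_map_def[of _ fscale]
    by (intro conjI allI linearI_vector_space vector_space_fscale vector_space_axioms)
      (simp_all add: pure3_def fscale_def fun_eq_iff *)
qed

end


section \<open>Relative PCA algebras\<close>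

definition commutator :: "('a \<Rightarrow> 'a \<Rightarrow> 'a) \<Rightarrow> 'a \<Rightarrow> 'a \<Rightarrow> 'a::ab_group_add"
  where "commutator circ x y = circ x y - circ y x"

locale comm_assoc_algebra = vector_space scale
  for scale :: "'k::field \<Rightarrow> 'a::ab_group_add \<Rightarrow> 'a"
    and mul :: "'a \<Rightarrow> 'a \<Rightarrow> 'a" +
  assumes mul_bilinear: "bilinear_map scale scale mul"
    and mul_comm: "mul x y = mul y x"
    and mul_assoc: "mul (mul x y) z = mul x (mul y z)"

locale lie_algebra = vector_space scale
  for scale :: "'k::field \<Rightarrow> 'a::ab_group_add \<Rightarrow> 'a"
    and br :: "'a \<Rightarrow> 'a \<Rightarrow> 'a" +
  assumes br_bilinear: "bilinear_map scale scale br"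
    and br_alternating: "br x x = 0"
    and br_jacobi: "br x (br y z) + br y (br z x) + br z (br x y) = 0"

locale relative_poisson_algebra = comm_assoc_algebra scale mul + lie_algebra scale br
  for scale :: "'k::field \<Rightarrow> 'a::ab_group_add \<Rightarrow> 'a"
    and mul br :: "'a \<Rightarrow> 'a \<Rightarrow> 'a" and P :: "'a \<Rightarrow> 'a" +
  assumes P_linear: "Vector_Spaces.linear scale scale P"
    and P_derivation_mul: "P (mul x y) = mul (P x) y + mul x (P y)"
    and P_derivation_br: "P (br x y) = br (P x) y + br x (P y)"
    and relative_leibniz: "br z (mul x y) = mul (br z x) y + mul x (br z y) + mul (mul x y) (P z)"

locale anti_pre_lie_algebra = vector_space scale
  for scale :: "'k::field \<Rightarrow> 'a::ab_group_add \<Rightarrow> 'a"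
    and circ :: "'a \<Rightarrow> 'a \<Rightarrow> 'a" +
  assumes circ_bilinear: "bilinear_map scale scale circ"
    and anti_pre_lie_1: "circ x (circ y z) - circ y (circ x z) = circ (commutator circ y x) z"
    and anti_pre_lie_2:
      "circ (commutator circ x y) z + circ (commutator circ y z) x + circ (commutator circ z x) y = 0"

locale relative_PCA_algebra =
    comm_assoc_algebra scale mul
  + anti_pre_lie_algebra scale circ
  + relative_poisson_algebra scale mul "commutator circ" P
  for scale :: "'k::field \<Rightarrow> 'a::ab_group_add \<Rightarrow> 'a"
    and mul circ :: "'a \<Rightarrow> 'a \<Rightarrow> 'a" and P Q :: "'a \<Rightarrow> 'a" +
  assumes Q_linear: "Vector_Spaces.linear scale scale Q"
    and PCA_mul_Q: "mul x (Q y) - mul (P x) y - Q (mul x y) = 0"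
    and PCA_circ_Q: "circ x (Q y) - circ (P x) y - Q (circ x y) = 0"
    and PCA_mixed_1:
      "mul x (circ y z) - circ y (mul x z) + mul (commutator circ x y) z - mul (mul x (P y)) z = 0"
    and PCA_mixed_2:
      "circ (mul x y) z - circ y (mul x z) - circ x (mul y z) + Q (mul (mul x y) z) = 0"


section \<open>Relative PCA coalgebras\<close>

locale cocomm_coassoc_coalgebra = tensor_powers scale
  for scale :: "'k::field \<Rightarrow> 'a::ab_group_add \<Rightarrow> 'a"
    and \<Delta> :: "'a \<Rightarrow> ('a, 'k) tensor2" +
  assumes Delta_linear: "Vector_Spaces.linear scale fscale \<Delta>"
    and Delta_in: "\<Delta> x \<in> Tensor2"
    and Delta_cocomm: "flip2 (\<Delta> x) = \<Delta> x"
    and Delta_coassoc: "co_right \<Delta> (\<Delta> x) = co_left \<Delta> (\<Delta> x)"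

locale anti_pre_lie_coalgebra = tensor_powers scale
  for scale :: "'k::field \<Rightarrow> 'a::ab_group_add \<Rightarrow> 'a"
    and \<theta> :: "'a \<Rightarrow> ('a, 'k) tensor2" +
  assumes theta_linear: "Vector_Spaces.linear scale fscale \<theta>"
    and theta_in: "\<theta> x \<in> Tensor2"
    and anti_pre_lie_co_1:
      "co_right \<theta> (\<theta> x) - flip3 (co_right \<theta> (\<theta> x)) = flip3 (co_left \<theta> (\<theta> x)) - co_left \<theta> (\<theta> x)"
    and anti_pre_lie_co_2:
      "let t = flip3 (co_left \<theta> (\<theta> x)) - co_left \<theta> (\<theta> x) in t + rot3 t + rot3 (rot3 t) = 0"

text \<open>In a relative PCA coalgebra \<open>(A, \<Delta>, \<theta>, Q, P)\<close>, \<open>Q\<close> comes before \<open>P\<close>: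
  \<open>Q\<close> is the coderivation, dual to the derivation \<open>P\<close> of a relative PCA algebra.\<close>

locale relative_PCA_coalgebra =
    cocomm_coassoc_coalgebra scale \<Delta>
  + anti_pre_lie_coalgebra scale \<theta>
  for scale :: "'k::field \<Rightarrow> 'a::ab_group_add \<Rightarrow> 'a"
    and \<Delta> \<theta> :: "'a \<Rightarrow> ('a, 'k) tensor2" and Q P :: "'a \<Rightarrow> 'a" +
  assumes co_Q_linear: "Vector_Spaces.linear scale scale Q"
    and co_P_linear: "Vector_Spaces.linear scale scale P"
    and co_Delta_Q: "\<Delta> (Q x) = tmap2 Q id (\<Delta> x) + tmap2 id Q (\<Delta> x)"
    and co_delta_Q: "cocommutator \<theta> (Q x) =
      tmap2 Q id (cocommutator \<theta> x) + tmap2 id Q (cocommutator \<theta> x)"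
    and co_leibniz: "co_right \<Delta> (cocommutator \<theta> x) - co_left (cocommutator \<theta>) (\<Delta> x)
      - flip3 (co_right (cocommutator \<theta>) (\<Delta> x)) - tmap3 Q id id (co_left \<Delta> (\<Delta> x)) = 0"
    and co_Delta_P: "\<Delta> (P x) = tmap2 id P (\<Delta> x) - tmap2 Q id (\<Delta> x)"
    and co_theta_P: "\<theta> (P x) = tmap2 id P (\<theta> x) - tmap2 Q id (\<theta> x)"
    and co_mixed_1: "co_right \<theta> (\<Delta> x) - flip3 (co_right \<Delta> (\<theta> x))
      + co_left (cocommutator \<theta>) (\<Delta> x) - tmap3 id Q id (co_left \<Delta> (\<Delta> x)) = 0"
    and co_mixed_2: "co_left \<Delta> (\<theta> x) =
      flip3 (co_right \<Delta> (\<theta> x)) + co_right \<Delta> (\<theta> x) - co_left \<Delta> (\<Delta> (P x))"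


section \<open>Relative PCA bialgebras\<close>

locale relative_PCA_bialgebra =
    relative_PCA_algebra scale mul circ P Q
  + relative_PCA_coalgebra scale \<Delta> \<theta> Q P
  for scale :: "'k::field \<Rightarrow> 'a::ab_group_add \<Rightarrow> 'a"
    and mul circ :: "'a \<Rightarrow> 'a \<Rightarrow> 'a"
    and \<Delta> \<theta> :: "'a \<Rightarrow> ('a, 'k) tensor2"
    and P Q :: "'a \<Rightarrow> 'a" +
  assumes bi_a: "\<Delta> (mul x y) = tmap2 (mul x) id (\<Delta> y) + tmap2 id (mul y) (\<Delta> x)"
    and bi_b1: "let t = \<theta> (circ x y) - tmap2 (circ x) id (\<theta> y) - tmap2 id (circ x) (\<theta> y)
        + tmap2 id (\<lambda>z. circ z y) (\<theta> x)
      in t - flip2 t = 0"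
    and bi_b2: "\<theta> (commutator circ x y) =
      (tmap2 id (commutator circ x) (\<theta> y) - tmap2 (circ x) id (\<theta> y))
      - (tmap2 id (commutator circ y) (\<theta> x) - tmap2 (circ y) id (\<theta> x))"
    and bi_c: "\<theta> (mul x y) + tmap2 (circ y) id (\<Delta> x) - tmap2 id (mul x) (\<theta> y)
      + tmap2 (circ x) id (\<Delta> y) - tmap2 id (mul y) (\<theta> x) - tmap2 Q id (\<Delta> (mul x y)) = 0"
    and bi_d: "\<Delta> (circ x y) + (flip2 (tmap2 id (mul y) (\<theta> x)) + tmap2 id (mul y) (\<theta> x))
      - (tmap2 id (circ x) (\<Delta> y) + tmap2 (circ x) id (\<Delta> y)) - \<Delta> (mul (P x) y) = 0"
    and bi_e: "(tmap2 (mul x) id (\<theta> y) - tmap2 id (mul x) (\<theta> y))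
      + (tmap2 (circ y) id (\<Delta> x) - tmap2 id (commutator circ y) (\<Delta> x))
      - \<Delta> (commutator circ x y) + \<Delta> (mul x (P y)) = 0"
    and bi_f: "tmap2 id (\<lambda>z. circ z y) (\<Delta> x) + tmap2 (mul x) id (cocommutator \<theta> y)
      - tmap2 id (circ x) (\<Delta> y) + flip2 (tmap2 id (mul y) (\<theta> x))
      - cocommutator \<theta> (mul x y) + tmap2 id Q (\<Delta> (mul x y)) = 0"


section \<open>The relative PCA Yang-Baxter equation\<close>

context tensor_powers
begin

text \<open>In the double sums over \<open>r = \<Sum>\<^sub>i a\<^sub>i \<otimes> b\<^sub>i\<close>, the outer \<open>ext2\<close> runs over \<open>(a\<^sub>i, b\<^sub>i)\<close>
  and the inner one over \<open>(a\<^sub>j, b\<^sub>j)\<close>.\<close>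

definition YB_A :: "('b \<Rightarrow> 'b \<Rightarrow> 'b) \<Rightarrow> ('b, 'a) tensor2 \<Rightarrow> ('b, 'a) tensor3"
  where "YB_A mul r = ext2 (\<lambda>ai bi. ext2 (\<lambda>aj bj.
    pure3 (mul ai aj) bi bj - pure3 ai (mul aj bi) bj + pure3 ai aj (mul bi bj)) r) r"

definition YB_T :: "('b \<Rightarrow> 'b \<Rightarrow> 'b) \<Rightarrow> ('b, 'a) tensor2 \<Rightarrow> ('b, 'a) tensor3"
  where "YB_T circ r = ext2 (\<lambda>ai bi. ext2 (\<lambda>aj bj.
    pure3 (circ ai aj) bi bj + pure3 ai (circ bi aj) bj - pure3 ai aj (commutator circ bi bj)) r) r"

definition RPCA_YBE ::
  "('b \<Rightarrow> 'b \<Rightarrow> 'b) \<Rightarrow> ('b \<Rightarrow> 'b \<Rightarrow> 'b) \<Rightarrow> ('b \<Rightarrow> 'b) \<Rightarrow> ('b \<Rightarrow> 'b) \<Rightarrow> ('b, 'a) tensor2 \<Rightarrow> bool"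
  where "RPCA_YBE mul circ P Q r \<longleftrightarrow>
    YB_A mul r = 0 \<and> YB_T circ r = 0 \<and>
    tmap2 Q id r - tmap2 id P r = 0 \<and> tmap2 P id r - tmap2 id Q r = 0"

definition antisymmetric_tensor :: "('b, 'a) tensor2 \<Rightarrow> bool"
  where "antisymmetric_tensor r \<longleftrightarrow> flip2 r = - r"

end

end

(*
  Pairing the first leg of r with linear forms gives a map rho from the dual space A* to A, and
  antisymmetry of r reads g (rho f) = - f (rho g). Transposing Delta and theta gives products on A*,
    (f * g) x = f (x . rho g) + g (x . rho f)  and  (f # g) x = - f (x o rho g) - g [x, rho f],
  and the equations A(r) = T(r) = 0 say exactly that rho is multiplicative for them, while the other
  two equations of the RPCA-YBE say that rho intertwines the transposes of P and Q with Q and P. Hence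
  a coalgebra axiom, paired with forms f, g, h, is a sum f u + g v + h w in which u, v and w are
  expressions in x, rho f, rho g, rho h that vanish by the axioms of a relative PCA algebra. The
  compatibility conditions (a)-(f) are linear in r, and split in the same way into two such terms.
*)
theory Submission
  imports Defs
begin

section \<open>Tensors in finite dimension\<close>

interpretation fscale: vector_space fscale
  by (rule vector_space_fscale)

lemma bilinear_map_linear:
  assumes "bilinear_map s s' \<phi>"
  shows "Vector_Spaces.linear s s' (\<phi> x)" and "Vector_Spaces.linear s s' (\<lambda>x. \<phi> x y)"
  using assms by (simp_all add: bilinear_map_def)

lemma bilinear_map_add_scale:
  assumes "bilinear_map s s' \<phi>"
  shows "\<phi> (x + x') y = \<phi> x y + \<phi> x' y" and "\<phi> (s c x) y = s' c (\<phi> x y)"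
    and "\<phi> x (y + y') = \<phi> x y + \<phi> x y'" and "\<phi> x (s c y) = s' c (\<phi> x y)"
  using linear_add_scale[OF bilinear_map_linear(1)[OF assms]]
    linear_add_scale[OF bilinear_map_linear(2)[OF assms]] by blast+

lemma linear_ext2: "Vector_Spaces.linear fscale fscale (ext2 \<phi>)"
  by (intro linearI_vector_space vector_space_fscale) (simp_all add: ext2_def fscale_def fun_eq_iff)

lemma linear_fscale_sum:
  fixes F :: "'i \<Rightarrow> 'b::ab_group_add \<Rightarrow> 'f \<Rightarrow> 'k::field"
  assumes "vector_space s" and "\<And>i. i \<in> I \<Longrightarrow> Vector_Spaces.linear s fscale (F i)"
  shows "Vector_Spaces.linear s fscale (\<lambda>x. \<Sum>i\<in>I. F i x)"
proof (rule linearI_vector_space[OF assms(1) vector_space_fscale])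
  show "(\<Sum>i\<in>I. F i (x + y)) = (\<Sum>i\<in>I. F i x) + (\<Sum>i\<in>I. F i y)" for x y
    by (simp add: linear_add_scale(1)[OF assms(2)] sum.distrib)
  show "(\<Sum>i\<in>I. F i (s c x)) = fscale c (\<Sum>i\<in>I. F i x)" for c x
    by (simp add: linear_add_scale(2)[OF assms(2)] fscale.scale_sum_right)
qed

context tensor_powers
begin

abbreviation form :: "('b \<Rightarrow> 'a) \<Rightarrow> bool"
  where "form \<equiv> Vector_Spaces.linear scale (*)"

lemma formI: "(\<And>x y. f (x + y) = f x + f y) \<Longrightarrow> (\<And>c x. f (scale c x) = c * f x) \<Longrightarrow> form f"
  by (rule linearI_vector_space[OF vector_space_axioms vector_space_mult])

lemma linear_diff_zero:
  assumes "Vector_Spaces.linear scale s' f"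
  shows "f (x - y) = f x - f y" and "f (- x) = - f x" and "f 0 = 0"
proof -
  interpret Vector_Spaces.linear scale s' f by (fact assms)
  show "f (x - y) = f x - f y" "f (- x) = - f x" "f 0 = 0"
    by (simp_all add: diff neg)
qed

lemmas form_simps = linear_add_scale[of scale "(*)"] linear_diff_zero[of "(*)"]

lemma form_comp: "form f \<Longrightarrow> Vector_Spaces.linear scale scale F \<Longrightarrow> form (f \<circ> F)"
  by (rule Vector_Spaces.linear_compose)

lemma bilinear_form_mult: "form f \<Longrightarrow> form g \<Longrightarrow> bilinear_map scale (*) (\<lambda>x y. f x * g y)"
  unfolding bilinear_map_def by (auto intro!: formI simp: form_simps algebra_simps)

lemma trilinear_form_mult:
  "form f \<Longrightarrow> form g \<Longrightarrow> form h \<Longrightarrow> trilinear_map scale (*) (\<lambda>x y z. f x * g y * h z)"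
  unfolding trilinear_map_def by (auto intro!: formI simp: form_simps algebra_simps)

section \<open>Decomposition into pure tensors and closure under the tensor operations\<close>

lemma pure2_in: "pure2 x y \<in> Tensor2"
  unfolding Tensor2_def by (auto intro: fscale.span_base)

lemma pure3_in: "pure3 x y z \<in> Tensor3"
  unfolding Tensor3_def by (auto intro: fscale.span_base)

lemma subspace_Tensor2: "fscale.subspace Tensor2"
  by (simp add: Tensor2_def fscale.subspace_span)

lemma subspace_Tensor3: "fscale.subspace Tensor3"
  by (simp add: Tensor3_def fscale.subspace_span)

lemmas Tensor2_closed = fscale.subspace_add[OF subspace_Tensor2] fscale.subspace_diff[OF subspace_Tensor2]
lemmas Tensor3_closed = fscale.subspace_0[OF subspace_Tensor3] fscale.subspace_add[OF subspace_Tensor3]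
  fscale.subspace_diff[OF subspace_Tensor3]

lemma Tensor2_cases:
  assumes "t \<in> Tensor2"
  obtains I :: "('b, 'a) tensor2 set" and u v where "t = (\<Sum>i\<in>I. pure2 (u i) (v i))"
proof -
  obtain I r where I: "I \<subseteq> {pure2 x y |x y. True}" and t: "t = (\<Sum>i\<in>I. fscale (r i) i)"
    using assms unfolding Tensor2_def fscale.span_explicit by blast
  \<comment> \<open>The scalar is absorbed into the second factor of the pure tensor.\<close>
  have "\<forall>i\<in>I. \<exists>x y. fscale (r i) i = pure2 x y"
    using I by (fastforce simp flip: linear_add_scale(2)[OF bilinear_map_linear(1)[OF bilinear_pure2]])
  then obtain u v where "\<forall>i\<in>I. fscale (r i) i = pure2 (u i) (v i)"
    by metis
  then show ?thesis
    using t that[of u v I] by simp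
qed

lemma Tensor3_cases:
  assumes "t \<in> Tensor3"
  obtains I :: "('b, 'a) tensor3 set" and u v w where "t = (\<Sum>i\<in>I. pure3 (u i) (v i) (w i))"
proof -
  obtain I r where I: "I \<subseteq> {pure3 x y z |x y z. True}" and t: "t = (\<Sum>i\<in>I. fscale (r i) i)"
    using assms unfolding Tensor3_def fscale.span_explicit by blast
  have "fscale c (pure3 x y z) = pure3 x y (scale c z)" for c x y z
    using trilinear_pure3 linear_add_scale(2) unfolding trilinear_map_def by metis
  then have "\<forall>i\<in>I. \<exists>x y z. fscale (r i) i = pure3 x y z"
    using I by fastforce
  then obtain u v w where "\<forall>i\<in>I. fscale (r i) i = pure3 (u i) (v i) (w i)"
    by metis
  then show ?thesis
    using t that[of u v w I] by simp
qed

lemma pure2_sum_apply: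
  "bilinear_map scale (*) \<beta> \<Longrightarrow> (\<Sum>i\<in>I. pure2 (u i) (v i)) \<beta> = (\<Sum>i\<in>I. \<beta> (u i) (v i))"
  by (simp add: sum_fun_apply pure2_def)

lemma pure3_sum_apply:
  "trilinear_map scale (*) \<gamma> \<Longrightarrow> (\<Sum>i\<in>I. pure3 (u i) (v i) (w i)) \<gamma> = (\<Sum>i\<in>I. \<gamma> (u i) (v i) (w i))"
  by (simp add: sum_fun_apply pure3_def)

text \<open>A value of type \<open>tensor2\<close> is merely a function, with no linearity in its
  argument. A member of \<open>Tensor2\<close> is linear on bilinear forms because it is a sum of
  pure tensors, which evaluate such forms at a point.\<close>

lemma Tensor2_apply:
  assumes t: "t \<in> Tensor2" and \<beta>: "bilinear_map scale (*) \<beta>" "bilinear_map scale (*) \<beta>'"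
  shows "t (\<lambda>x y. \<beta> x y + \<beta>' x y) = t \<beta> + t \<beta>'"
    and "t (\<lambda>x y. c * \<beta> x y) = c * t \<beta>"
proof -
  obtain I :: "('b, 'a) tensor2 set" and u v where t: "t = (\<Sum>i\<in>I. pure2 (u i) (v i))"
    using t by (rule Tensor2_cases)
  have "bilinear_map scale (*) (\<lambda>x y. \<beta> x y + \<beta>' x y)"
    "bilinear_map scale (*) (\<lambda>x y. c * \<beta> x y)"
    unfolding bilinear_map_def
    by (auto intro!: formI simp: bilinear_map_add_scale[OF \<beta>(1)] bilinear_map_add_scale[OF \<beta>(2)]
        algebra_simps)
  then show "t (\<lambda>x y. \<beta> x y + \<beta>' x y) = t \<beta> + t \<beta>'"
    "t (\<lambda>x y. c * \<beta> x y) = c * t \<beta>"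
    using \<beta> by (simp_all add: t pure2_sum_apply sum.distrib sum_distrib_left)
qed

text \<open>The subspace \<open>S\<close> is arbitrary since \<open>tmap2\<close> and
  \<open>flip2\<close> land in \<open>Tensor2\<close>, but \<open>co_left\<close> and
  \<open>co_right\<close> in \<open>Tensor3\<close>.\<close>

lemma ext2_in:
  assumes "bilinear_map scale fscale \<phi>" and "fscale.subspace S" and "\<And>x y. \<phi> x y \<in> S" and "t \<in> Tensor2"
  shows "ext2 \<phi> t \<in> S"
proof -
  obtain I :: "('b, 'a) tensor2 set" and u v where t: "t = (\<Sum>i\<in>I. pure2 (u i) (v i))"
    using assms(4) by (rule Tensor2_cases)
  show ?thesis
    unfolding t ext2_sum_pure2[OF assms(1)] using assms(2,3) by (rule fscale.subspace_sum)
qed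

lemma ext3_in:
  assumes "trilinear_map scale fscale \<phi>" and "\<And>x y z. \<phi> x y z \<in> Tensor3" and "t \<in> Tensor3"
  shows "ext3 \<phi> t \<in> Tensor3"
proof -
  obtain I :: "('b, 'a) tensor3 set" and u v w where t: "t = (\<Sum>i\<in>I. pure3 (u i) (v i) (w i))"
    using assms(3) by (rule Tensor3_cases)
  show ?thesis
    unfolding t ext3_sum_pure3[OF assms(1)] using subspace_Tensor3 assms(2) by (rule fscale.subspace_sum)
qed

lemma pure3_linear:
  "Vector_Spaces.linear scale fscale (\<lambda>z. pure3 x y z)"
  "Vector_Spaces.linear scale fscale (\<lambda>y. pure3 x y z)"
  "Vector_Spaces.linear scale fscale (\<lambda>x. pure3 x y z)"
  using trilinear_pure3 by (simp_all add: trilinear_map_def)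

lemma tmap2_in:
  assumes "Vector_Spaces.linear scale scale F" "Vector_Spaces.linear scale scale G" "t \<in> Tensor2"
  shows "tmap2 F G t \<in> Tensor2"
  unfolding tmap2_def
proof (rule ext2_in[OF _ subspace_Tensor2 pure2_in assms(3)])
  show "bilinear_map scale fscale (\<lambda>x y. pure2 (F x) (G y))"
    unfolding bilinear_map_def
    by (intro conjI allI linear_compose_form[OF bilinear_map_linear(1)[OF bilinear_pure2]]
        linear_compose_form[OF bilinear_map_linear(2)[OF bilinear_pure2]] assms)
qed

lemma flip2_in: "t \<in> Tensor2 \<Longrightarrow> flip2 t \<in> Tensor2"
  unfolding flip2_def
  by (rule ext2_in[OF _ subspace_Tensor2 pure2_in])
    (use bilinear_pure2 in \<open>simp add: bilinear_map_def\<close>)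

lemma tmap3_in:
  assumes "Vector_Spaces.linear scale scale F" "Vector_Spaces.linear scale scale G"
    "Vector_Spaces.linear scale scale H" "t \<in> Tensor3"
  shows "tmap3 F G H t \<in> Tensor3"
  unfolding tmap3_def
proof (rule ext3_in[OF _ pure3_in assms(4)])
  show "trilinear_map scale fscale (\<lambda>x y z. pure3 (F x) (G y) (H z))"
    unfolding trilinear_map_def
    by (intro conjI allI linear_compose_form[OF pure3_linear(1)]
        linear_compose_form[OF pure3_linear(2)] linear_compose_form[OF pure3_linear(3)] assms)
qed

lemma flip3_in: "t \<in> Tensor3 \<Longrightarrow> flip3 t \<in> Tensor3"
  unfolding flip3_def
  by (rule ext3_in[OF _ pure3_in]) (simp add: trilinear_map_def pure3_linear)

lemma rot3_in: "t \<in> Tensor3 \<Longrightarrow> rot3 t \<in> Tensor3"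
  unfolding rot3_def
  by (rule ext3_in[OF _ pure3_in]) (simp add: trilinear_map_def pure3_linear)

lemma co_in:
  assumes d: "Vector_Spaces.linear scale fscale d" "\<And>x. d x \<in> Tensor2" and t: "t \<in> Tensor2"
  shows co_left_in: "co_left d t \<in> Tensor3" and co_right_in: "co_right d t \<in> Tensor3"
proof -
  have b: "bilinear_map scale fscale (\<lambda>p q. pure3 p q y)"
    "bilinear_map scale fscale (\<lambda>p q. pure3 y p q)" for y
    by (simp_all add: bilinear_map_def pure3_linear)
  \<comment> \<open>Here \<open>y\<close> sits inside the extended map, so
    \<open>linear_ext2\<close> does not apply. Expanding \<open>d x\<close> into pure tensors
    reduces the claim to linearity of \<open>pure3\<close>.\<close>
  have l: "Vector_Spaces.linear scale fscale (\<lambda>y. ext2 (\<lambda>p q. pure3 p q y) (d x))"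
    "Vector_Spaces.linear scale fscale (\<lambda>y. ext2 (\<lambda>p q. pure3 y p q) (d x))" for x
  proof -
    obtain I :: "('b, 'a) tensor2 set" and u v where dx: "d x = (\<Sum>i\<in>I. pure2 (u i) (v i))"
      using d(2) by (rule Tensor2_cases)
    show "Vector_Spaces.linear scale fscale (\<lambda>y. ext2 (\<lambda>p q. pure3 p q y) (d x))"
      "Vector_Spaces.linear scale fscale (\<lambda>y. ext2 (\<lambda>p q. pure3 y p q) (d x))"
      unfolding dx ext2_sum_pure2[OF b(1)] ext2_sum_pure2[OF b(2)]
      by (intro linear_fscale_sum vector_space_axioms pure3_linear)+
  qed
  show "co_left d t \<in> Tensor3"
    unfolding co_left_def
    by (rule ext2_in[OF _ subspace_Tensor3 ext2_in[OF b(1) subspace_Tensor3 pure3_in d(2)] t])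
      (simp add: bilinear_map_def l linear_compose_form[OF linear_ext2 d(1)])
  show "co_right d t \<in> Tensor3"
    unfolding co_right_def
    by (rule ext2_in[OF _ subspace_Tensor3 ext2_in[OF b(2) subspace_Tensor3 pure3_in d(2)] t])
      (simp add: bilinear_map_def l linear_compose_form[OF linear_ext2 d(1)])
qed

lemma linear_cocommutator:
  "Vector_Spaces.linear scale fscale d \<Longrightarrow> Vector_Spaces.linear scale fscale (cocommutator d)"
  by (intro linearI_vector_space vector_space_axioms vector_space_fscale)
    (simp_all add: cocommutator_def linear_add_scale[of scale fscale d] flip2_def ext2_def fscale_def
      fun_eq_iff algebra_simps)

lemma cocommutator_in: "(\<And>x. d x \<in> Tensor2) \<Longrightarrow> cocommutator d x \<in> Tensor2"
  by (simp add: cocommutator_def Tensor2_closed flip2_in)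

subsection \<open>Pairing with linear forms\<close>

definition pair2 :: "('b, 'a) tensor2 \<Rightarrow> ('b \<Rightarrow> 'a) \<Rightarrow> ('b \<Rightarrow> 'a) \<Rightarrow> 'a"
  where "pair2 t f g = t (\<lambda>x y. f x * g y)"

definition pair3 :: "('b, 'a) tensor3 \<Rightarrow> ('b \<Rightarrow> 'a) \<Rightarrow> ('b \<Rightarrow> 'a) \<Rightarrow> ('b \<Rightarrow> 'a) \<Rightarrow> 'a"
  where "pair3 t f g h = t (\<lambda>x y z. f x * g y * h z)"

text \<open>The transpose of the comultiplication \<open>d\<close>, a product on the dual
  space.\<close>

definition dual_product :: "('b \<Rightarrow> ('b, 'a) tensor2) \<Rightarrow> ('b \<Rightarrow> 'a) \<Rightarrow> ('b \<Rightarrow> 'a) \<Rightarrow> 'b \<Rightarrow> 'a"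
  where "dual_product d f g x = pair2 (d x) f g"

lemma pair_lin [simp]:
  "pair2 (s + t) f g = pair2 s f g + pair2 t f g"
  "pair2 (s - t) f g = pair2 s f g - pair2 t f g"
  "pair2 (- t) f g = - pair2 t f g"
  "pair2 0 f g = 0"
  "pair3 (s' + t') f g h = pair3 s' f g h + pair3 t' f g h"
  "pair3 (s' - t') f g h = pair3 s' f g h - pair3 t' f g h"
  "pair3 (- t') f g h = - pair3 t' f g h"
  "pair3 0 f g h = 0"
  by (simp_all add: pair2_def pair3_def)

lemma pair2_tmap2 [simp]: "form f \<Longrightarrow> form g \<Longrightarrow> pair2 (tmap2 F G t) f g = pair2 t (f \<circ> F) (g \<circ> G)"
  by (simp add: pair2_def tmap2_def ext2_def pure2_def bilinear_form_mult)

lemma pair2_flip2 [simp]: "form f \<Longrightarrow> form g \<Longrightarrow> pair2 (flip2 t) f g = pair2 t g f"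
  by (simp add: pair2_def flip2_def ext2_def pure2_def bilinear_form_mult mult.commute)

lemma pair3_tmap3 [simp]:
  "form f \<Longrightarrow> form g \<Longrightarrow> form h \<Longrightarrow>
    pair3 (tmap3 F G H t) f g h = pair3 t (f \<circ> F) (g \<circ> G) (h \<circ> H)"
  by (simp add: pair3_def tmap3_def ext3_def pure3_def trilinear_form_mult)

lemma pair3_flip3 [simp]:
  "form f \<Longrightarrow> form g \<Longrightarrow> form h \<Longrightarrow> pair3 (flip3 t) f g h = pair3 t g f h"
  by (simp add: pair3_def flip3_def ext3_def pure3_def trilinear_form_mult) (simp add: mult_ac)

lemma pair3_rot3 [simp]:
  "form f \<Longrightarrow> form g \<Longrightarrow> form h \<Longrightarrow> pair3 (rot3 t) f g h = pair3 t h f g"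
  by (simp add: pair3_def rot3_def ext3_def pure3_def trilinear_form_mult) (simp add: mult_ac)

text \<open>Contracting the two legs created by \<open>d\<close> first leaves a pairing on two legs,
  so an iterated comultiplication becomes an iterated product of forms.\<close>

lemma pair3_co:
  assumes "\<And>x. d x \<in> Tensor2" and "form f" "form g" "form h"
  shows pair3_co_left: "pair3 (co_left d t) f g h = pair2 t (dual_product d f g) h"
    and pair3_co_right: "pair3 (co_right d t) f g h = pair2 t f (dual_product d g h)"
proof -
  \<comment> \<open>For the inner tensor, the form on the remaining leg is a constant factor
    \<open>c\<close>, which homogeneity takes out.\<close>
  have scale: "d x (\<lambda>p q. c * (f' p * g' q)) = c * pair2 (d x) f' g'" if "form f'" "form g'" for x c f' g'
    using Tensor2_apply(2)[OF assms(1)] bilinear_form_mult[OF that] by (simp add: pair2_def)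
  show "pair3 (co_left d t) f g h = pair2 t (dual_product d f g) h"
    using scale[of f g _ "h _"] assms(2-4)
    by (simp add: pair3_def co_left_def ext2_def pure3_def trilinear_form_mult dual_product_def
        pair2_def[of t]) (simp add: mult.commute[of _ "h _"])
  show "pair3 (co_right d t) f g h = pair2 t f (dual_product d g h)"
    using scale[of g h _ "f _"] assms(2-4)
    by (simp add: pair3_def co_right_def ext2_def pure3_def trilinear_form_mult dual_product_def
        pair2_def[of t]) (simp add: mult.assoc)
qed

lemma form_dual_product:
  "Vector_Spaces.linear scale fscale d \<Longrightarrow> form (dual_product d f g)"
  by (rule formI) (simp_all add: dual_product_def linear_add_scale[of scale fscale d] pair2_def fscale_def)

section \<open>Separation of tensors by products of linear forms in finite dimension\<close>

lemma dual_basis: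
  assumes "finite_dimensional_vector_space scale Basis"
  obtains e where "\<And>b. form (e b)" and "\<And>f x. form f \<Longrightarrow> f x = (\<Sum>b\<in>Basis. e b x * f b)"
proof -
  interpret fd: finite_dimensional_vector_space scale Basis by (fact assms)
  \<comment> \<open>These are the coordinates with respect to \<open>Basis\<close>; for
    \<open>b\<close> outside \<open>Basis\<close> the value is \<open>0\<close>, so
    \<open>e b\<close> is a form for every \<open>b\<close>.\<close>
  define e where "e b x = representation Basis x b" for b x
  show ?thesis
  proof
    show "form (e b)" for b
      by (rule formI) (simp_all add: e_def fd.independent_Basis fd.span_Basis representation_add representation_scale)
    fix f x assume f: "form f"
    interpret f: Vector_Spaces.linear scale "(*)" f by (fact f)
    have "f x = f (\<Sum>b\<in>Basis. scale (e b x) b)"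
      unfolding e_def using sum_representation_eq[OF fd.independent_Basis, of x Basis] fd.span_Basis
      by (simp add: fd.finite_Basis)
    then show "f x = (\<Sum>b\<in>Basis. e b x * f b)"
      by (simp add: f.sum f.scale)
  qed
qed

text \<open>Every bilinear form is a combination of products of coordinate forms, so a tensor is
  determined on it by pairings; on all other functions members of \<open>Tensor2\<close> are
  \<open>0\<close>.\<close>

lemma Tensor2_eqI:
  assumes "finite_dimensional_vector_space scale Basis" and "s \<in> Tensor2" "t \<in> Tensor2"
    and eq: "\<And>f g. form f \<Longrightarrow> form g \<Longrightarrow> pair2 s f g = pair2 t f g"
  shows "s = t"
proof
  fix \<beta>
  obtain e where e: "\<And>b. form (e b)" "\<And>f x. form f \<Longrightarrow> f x = (\<Sum>b\<in>Basis. e b x * f b)"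
    using dual_basis[OF assms(1)] by blast
  have *: "t \<beta> = (if bilinear_map scale (*) \<beta> then \<Sum>b\<in>Basis. \<Sum>c\<in>Basis. pair2 t (e b) (e c) * \<beta> b c else 0)"
    if t: "t \<in> Tensor2" for t
  proof (cases "bilinear_map scale (*) \<beta>")
    case True
    obtain I :: "('b, 'a) tensor2 set" and u v where t: "t = (\<Sum>i\<in>I. pure2 (u i) (v i))"
      using t by (rule Tensor2_cases)
    have expand: "\<beta> x y = (\<Sum>b\<in>Basis. \<Sum>c\<in>Basis. e b x * e c y * \<beta> b c)" for x y
    proof -
      have "\<beta> x y = (\<Sum>b\<in>Basis. e b x * \<beta> b y)"
        by (rule e(2)[OF bilinear_map_linear(2)[OF True]])
      also have "\<dots> = (\<Sum>b\<in>Basis. e b x * (\<Sum>c\<in>Basis. e c y * \<beta> b c))"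
        by (intro sum.cong refl arg_cong[where f = "(*) _"] e(2)[OF bilinear_map_linear(1)[OF True]])
      finally show ?thesis
        by (simp add: sum_distrib_left mult.assoc)
    qed
    have "t \<beta> = (\<Sum>i\<in>I. \<Sum>b\<in>Basis. \<Sum>c\<in>Basis. e b (u i) * e c (v i) * \<beta> b c)"
      unfolding t pure2_sum_apply[OF True] by (intro sum.cong refl expand)
    also have "\<dots> = (\<Sum>b\<in>Basis. \<Sum>c\<in>Basis. pair2 t (e b) (e c) * \<beta> b c)"
      unfolding t pair2_def pure2_sum_apply[OF bilinear_form_mult[OF e(1) e(1)]] sum_distrib_right
      by (subst sum.swap, intro sum.cong refl, rule sum.swap)
    finally show ?thesis using True by simp
  next
    case False
    then show ?thesis
      using t by (auto elim!: Tensor2_cases simp: sum_fun_apply pure2_def)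
  qed
  show "s \<beta> = t \<beta>"
    using assms(2,3) by (simp add: * eq e(1))
qed

lemma Tensor3_eqI:
  assumes "finite_dimensional_vector_space scale Basis" and "s \<in> Tensor3" "t \<in> Tensor3"
    and eq: "\<And>f g h. form f \<Longrightarrow> form g \<Longrightarrow> form h \<Longrightarrow> pair3 s f g h = pair3 t f g h"
  shows "s = t"
proof
  fix \<gamma>
  obtain e where e: "\<And>b. form (e b)" "\<And>f x. form f \<Longrightarrow> f x = (\<Sum>b\<in>Basis. e b x * f b)"
    using dual_basis[OF assms(1)] by blast
  have *: "t \<gamma> = (if trilinear_map scale (*) \<gamma>
      then \<Sum>b\<in>Basis. \<Sum>c\<in>Basis. \<Sum>d\<in>Basis. pair3 t (e b) (e c) (e d) * \<gamma> b c d else 0)"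
    if t: "t \<in> Tensor3" for t
  proof (cases "trilinear_map scale (*) \<gamma>")
    case True
    obtain I :: "('b, 'a) tensor3 set" and u v w where t: "t = (\<Sum>i\<in>I. pure3 (u i) (v i) (w i))"
      using t by (rule Tensor3_cases)
    have \<gamma>: "form (\<lambda>x. \<gamma> x y z)" "form (\<lambda>y. \<gamma> x y z)" "form (\<lambda>z. \<gamma> x y z)" for x y z
      using True by (simp_all add: trilinear_map_def)
    have expand: "\<gamma> x y z = (\<Sum>b\<in>Basis. \<Sum>c\<in>Basis. \<Sum>d\<in>Basis. e b x * e c y * e d z * \<gamma> b c d)" for x y z
    proof -
      have "\<gamma> x y z = (\<Sum>b\<in>Basis. e b x * \<gamma> b y z)"
        by (rule e(2)[OF \<gamma>(1)])
      also have "\<dots> = (\<Sum>b\<in>Basis. e b x * (\<Sum>c\<in>Basis. e c y * \<gamma> b c z))"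
        by (intro sum.cong refl arg_cong[where f = "(*) _"] e(2)[OF \<gamma>(2)])
      also have "\<dots> = (\<Sum>b\<in>Basis. e b x * (\<Sum>c\<in>Basis. e c y * (\<Sum>d\<in>Basis. e d z * \<gamma> b c d)))"
        by (intro sum.cong refl arg_cong[where f = "(*) _"] e(2)[OF \<gamma>(3)])
      finally show ?thesis
        by (simp add: sum_distrib_left mult.assoc)
    qed
    have "t \<gamma> = (\<Sum>i\<in>I. \<Sum>b\<in>Basis. \<Sum>c\<in>Basis. \<Sum>d\<in>Basis.
        e b (u i) * e c (v i) * e d (w i) * \<gamma> b c d)"
      unfolding t pure3_sum_apply[OF True] by (intro sum.cong refl expand)
    also have "\<dots> = (\<Sum>b\<in>Basis. \<Sum>c\<in>Basis. \<Sum>d\<in>Basis. pair3 t (e b) (e c) (e d) * \<gamma> b c d)"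
      unfolding t pair3_def pure3_sum_apply[OF trilinear_form_mult[OF e(1) e(1) e(1)]] sum_distrib_right
      by (subst sum.swap, intro sum.cong refl, subst sum.swap, intro sum.cong refl, rule sum.swap)
    finally show ?thesis using True by simp
  next
    case False
    then show ?thesis
      using t by (auto elim!: Tensor3_cases simp: sum_fun_apply pure3_def)
  qed
  show "s \<gamma> = t \<gamma>"
    using assms(2,3) by (simp add: * eq e(1))
qed

end

section \<open>Antisymmetric solutions of the Yang-Baxter equation\<close>

text \<open>\<Delta> and \<theta> are parameters tied to \<open>r\<close> by equations, so that the
  conclusion applies directly to the maps of the theorem.\<close>

locale RPCA_YBE_solution = relative_PCA_algebra scale mul circ P Q + tensor_powers scale
  for scale :: "'k::field \<Rightarrow> 'a::ab_group_add \<Rightarrow> 'a"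
    and mul circ :: "'a \<Rightarrow> 'a \<Rightarrow> 'a" and P Q :: "'a \<Rightarrow> 'a" +
  fixes Basis :: "'a set" and r :: "('a, 'k) tensor2" and \<Delta> \<theta> :: "'a \<Rightarrow> ('a, 'k) tensor2"
  assumes finite_dim: "finite_dimensional_vector_space scale Basis"
    and r_in: "r \<in> Tensor2"
    and r_antisym: "antisymmetric_tensor r"
    and r_YBE: "RPCA_YBE mul circ P Q r"
    and Delta_eq: "\<Delta> x = tmap2 id (mul x) r - tmap2 (mul x) id r"
    and theta_eq: "\<theta> x = tmap2 (circ x) id r - tmap2 id (commutator circ x) r"
begin

abbreviation br :: "'a \<Rightarrow> 'a \<Rightarrow> 'a"
  where "br \<equiv> commutator circ"

lemma mul_left_comm: "mul x (mul y z) = mul y (mul x z)"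
  by (metis mul_comm mul_assoc)

lemma linear_ops:
  "Vector_Spaces.linear scale scale (mul x)" "Vector_Spaces.linear scale scale (\<lambda>z. mul z x)"
  "Vector_Spaces.linear scale scale (circ x)" "Vector_Spaces.linear scale scale (\<lambda>z. circ z x)"
  "Vector_Spaces.linear scale scale (br x)" "Vector_Spaces.linear scale scale (\<lambda>z. br z x)"
  "Vector_Spaces.linear scale scale id"
  using mul_bilinear circ_bilinear br_bilinear linear_id by (simp_all add: bilinear_map_def)

lemmas linear_maps = linear_ops P_linear Q_linear

lemmas op_simps =
  linear_add_scale[OF linear_ops(1)] linear_diff_zero[OF linear_ops(1)]
  linear_add_scale[OF linear_ops(2)] linear_diff_zero[OF linear_ops(2)]
  linear_add_scale[OF linear_ops(3)] linear_diff_zero[OF linear_ops(3)]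
  linear_add_scale[OF linear_ops(4)] linear_diff_zero[OF linear_ops(4)]
  linear_add_scale[OF P_linear] linear_diff_zero[OF P_linear]
  linear_add_scale[OF Q_linear] linear_diff_zero[OF Q_linear]

lemmas form_comps [simp] = linear_maps[THEN form_comp[rotated]]

section \<open>The map \<open>rho\<close> from the dual space to the algebra\<close>

lemma form_eqI: "(\<And>f. form f \<Longrightarrow> f x = f y) \<Longrightarrow> x = y"
  using zero_if_forms_zero[OF vector_space_axioms, of "x - y"] by (simp add: form_simps)

text \<open>If \<open>r = \<Sum>\<^sub>i a\<^sub>i \<otimes> b\<^sub>i\<close>, the unique such \<open>x\<close> is \<open>\<Sum>\<^sub>i f(a\<^sub>i) b\<^sub>i\<close>.\<close>

definition rho :: "('a \<Rightarrow> 'k) \<Rightarrow> 'a"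
  where "rho f = (SOME x. \<forall>g. form g \<longrightarrow> pair2 r f g = g x)"

lemma pair2_r:
  assumes "form f" "form g"
  shows "pair2 r f g = g (rho f)"
proof -
  obtain I :: "('a, 'k) tensor2 set" and u v where r: "r = (\<Sum>i\<in>I. pure2 (u i) (v i))"
    using r_in by (rule Tensor2_cases)
  have "pair2 r f g' = g' (\<Sum>i\<in>I. scale (f (u i)) (v i))" if "form g'" for g'
  proof -
    interpret Vector_Spaces.linear scale "(*)" g' by (fact that)
    show ?thesis
      by (simp add: r pair2_def pure2_sum_apply bilinear_form_mult assms(1) that sum scale)
  qed
  then have "\<exists>x. \<forall>g. form g \<longrightarrow> pair2 r f g = g x" by blast
  then show ?thesis
    unfolding rho_def by (rule someI2_ex) (use assms(2) in blast)
qed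

lemma rho_antisym:
  assumes "form f" "form g"
  shows "g (rho f) = - f (rho g)"
proof -
  have "pair2 (flip2 r) g f = pair2 (- r) g f"
    using r_antisym by (simp add: antisymmetric_tensor_def)
  then show ?thesis
    using assms by (simp add: pair2_r)
qed

text \<open>For a general operator \<open>F\<close>, antisymmetry moves \<open>F\<close> from inside
  \<open>rho\<close> to the outside, at the cost of exchanging the forms.\<close>

lemma rho_comp:
  assumes "form f" "form g" "Vector_Spaces.linear scale scale F"
  shows "g (rho (f \<circ> F)) = - f (F (rho g))"
  using rho_antisym[OF form_comp[OF assms(1,3)] assms(2)] by simp

text \<open>Pairing \<open>(P \<otimes> id - id \<otimes> Q) r = 0\<close> with \<open>f\<close> and
  \<open>g\<close> gives \<open>g (rho (f \<circ> P)) = g (Q (rho f))\<close>, and forms separate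
  points; the other equation exchanges \<open>P\<close> and \<open>Q\<close>.\<close>

lemma rho_P [simp]: "form f \<Longrightarrow> rho (f \<circ> P) = Q (rho f)"
  and rho_Q [simp]: "form f \<Longrightarrow> rho (f \<circ> Q) = P (rho f)"
proof -
  assume f: "form f"
  have *: "pair2 (tmap2 P id r) f g = pair2 (tmap2 id Q r) f g"
    "pair2 (tmap2 Q id r) f g = pair2 (tmap2 id P r) f g" for g
    using r_YBE by (simp_all add: RPCA_YBE_def)
  have "g (rho (f \<circ> P)) = g (Q (rho f))" "g (rho (f \<circ> Q)) = g (P (rho f))" if "form g" for g
    using *[of g] that f by (simp_all add: pair2_r)
  then show "rho (f \<circ> P) = Q (rho f)" "rho (f \<circ> Q) = P (rho f)"
    by (simp_all add: form_eqI)
qed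

section \<open>The Yang-Baxter equation paired with linear forms\<close>

text \<open>This is the shape of both the inner and the outer sum over \<open>r\<close> in
  \<open>YB_A\<close> and \<open>YB_T\<close>; in the inner sum the constants hold the factors of
  the outer legs.\<close>

lemma r_comb3:
  assumes "form f\<^sub>1" "form g\<^sub>1" "form f\<^sub>2" "form g\<^sub>2" "form f\<^sub>3" "form g\<^sub>3"
  shows "r (\<lambda>x y. c\<^sub>1 * (f\<^sub>1 x * g\<^sub>1 y) + c\<^sub>2 * (f\<^sub>2 x * g\<^sub>2 y) + c\<^sub>3 * (f\<^sub>3 x * g\<^sub>3 y))
    = c\<^sub>1 * g\<^sub>1 (rho f\<^sub>1) + c\<^sub>2 * g\<^sub>2 (rho f\<^sub>2) + c\<^sub>3 * g\<^sub>3 (rho f\<^sub>3)"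
proof -
  have b: "bilinear_map scale (*) (\<lambda>x y. c * (f x * g y))" if "form f" "form g" for c f g
    using that unfolding bilinear_map_def by (auto intro!: formI simp: form_simps algebra_simps)
  have b2: "bilinear_map scale (*) (\<lambda>x y. c\<^sub>1 * (f\<^sub>1 x * g\<^sub>1 y) + c\<^sub>2 * (f\<^sub>2 x * g\<^sub>2 y))"
    using assms unfolding bilinear_map_def by (auto intro!: formI simp: form_simps algebra_simps)
  show ?thesis
    using assms
    by (simp add: Tensor2_apply(1)[OF r_in b2 b] Tensor2_apply(1)[OF r_in b b]
        Tensor2_apply(2)[OF r_in bilinear_form_mult bilinear_form_mult] flip: pair2_r pair2_def)
qed

lemma pair3_YB_A:
  assumes f: "form f" and g: "form g" and h: "form h"
  shows "pair3 (YB_A mul r) f g h =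
    f (mul (rho g) (rho h)) + g (mul (rho h) (rho f)) + h (mul (rho f) (rho g))"
proof -
  \<comment> \<open>Summing over the second copy of \<open>r\<close> yields terms such as
    \<open>h (rho (f \<circ> mul a))\<close>. Antisymmetry turns this one into
    \<open>- f (mul a (rho h))\<close>, so the result is again a three-term combination, now in the
    outer legs \<open>a\<close> and \<open>b\<close>.\<close>
  have inner: "r (\<lambda>c d. f (mul a c) * g b * h d - f a * g (mul c b) * h d + f a * g c * h (mul b d)) =
      (- 1) * ((f \<circ> (\<lambda>z. mul z (rho h))) a * g b) + 1 * (f a * (g \<circ> mul (rho h)) b)
        + 1 * (f a * (h \<circ> (\<lambda>z. mul z (rho g))) b)" for a b
  proof -
    have "(\<lambda>c d. f (mul a c) * g b * h d - f a * g (mul c b) * h d + f a * g c * h (mul b d)) =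
      (\<lambda>c d. g b * ((f \<circ> mul a) c * h d) + (- f a) * ((g \<circ> (\<lambda>z. mul z b)) c * h d)
        + f a * (g c * (h \<circ> mul b) d))"
      by (simp add: fun_eq_iff algebra_simps)
    then show ?thesis
      by (simp only:, subst r_comb3)
        (use assms in \<open>simp_all add: rho_comp[of f h] rho_comp[of g h] rho_antisym[of g "h \<circ> _"] linear_maps\<close>)
  qed
  have "pair3 (YB_A mul r) f g h =
      r (\<lambda>a b. r (\<lambda>c d. f (mul a c) * g b * h d - f a * g (mul c b) * h d + f a * g c * h (mul b d)))"
    using assms by (simp add: pair3_def YB_A_def ext2_def pure3_def trilinear_form_mult)
  also have "\<dots> = f (mul (rho g) (rho h)) + g (mul (rho h) (rho f)) + h (mul (rho f) (rho g))"
    unfolding inner by (subst r_comb3) (use assms in \<open>simp_all add: rho_comp[of f g] linear_maps\<close>)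
  finally show ?thesis .
qed

lemma pair3_YB_T:
  assumes f: "form f" and g: "form g" and h: "form h"
  shows "pair3 (YB_T circ r) f g h =
    f (circ (rho g) (rho h)) - g (circ (rho f) (rho h)) - h (br (rho f) (rho g))"
proof -
  have inner: "r (\<lambda>c d. f (circ a c) * g b * h d + f a * g (circ b c) * h d - f a * g c * h (br b d)) =
      (- 1) * ((f \<circ> (\<lambda>z. circ z (rho h))) a * g b) + (- 1) * (f a * (g \<circ> (\<lambda>z. circ z (rho h))) b)
        + (- 1) * (f a * (h \<circ> (\<lambda>z. br z (rho g))) b)" for a b
  proof -
    have "(\<lambda>c d. f (circ a c) * g b * h d + f a * g (circ b c) * h d - f a * g c * h (br b d)) =
      (\<lambda>c d. g b * ((f \<circ> circ a) c * h d) + f a * ((g \<circ> circ b) c * h d)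
        + (- f a) * (g c * (h \<circ> br b) d))"
      by (simp add: fun_eq_iff algebra_simps)
    then show ?thesis
      by (simp only:, subst r_comb3)
        (use assms in \<open>simp_all add: rho_comp[of f h] rho_comp[of g h] rho_antisym[of g "h \<circ> _"] linear_maps\<close>)
  qed
  have "pair3 (YB_T circ r) f g h =
      r (\<lambda>a b. r (\<lambda>c d. f (circ a c) * g b * h d + f a * g (circ b c) * h d - f a * g c * h (br b d)))"
    using assms by (simp add: pair3_def YB_T_def ext2_def pure3_def trilinear_form_mult)
  also have "\<dots> = f (circ (rho g) (rho h)) - g (circ (rho f) (rho h)) - h (br (rho f) (rho g))"
    unfolding inner by (subst r_comb3) (use assms in \<open>simp_all add: rho_comp[of f g] linear_maps\<close>)
  finally show ?thesis .
qed

section \<open>The dual products of \<Delta> and \<theta>, and multiplicativity of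
  \<open>rho\<close>\<close>

lemma pair2_Delta [simp]:
  assumes "form f" "form g"
  shows "pair2 (\<Delta> x) f g = f (mul x (rho g)) + g (mul x (rho f))"
  using assms by (simp add: Delta_eq pair2_r rho_comp linear_maps)

lemma pair2_theta [simp]:
  assumes "form f" "form g"
  shows "pair2 (\<theta> x) f g = - f (circ x (rho g)) - g (br x (rho f))"
  using assms by (simp add: theta_eq pair2_r rho_comp linear_maps)

text \<open>Under antisymmetrization the left multiplications by \<open>x\<close> cancel against
  halves of the commutators, leaving right multiplications by \<open>x\<close>.\<close>

lemma pair2_delta [simp]:
  assumes "form f" "form g"
  shows "pair2 (cocommutator \<theta> x) f g = g (circ (rho f) x) - f (circ (rho g) x)"
  using assms by (simp add: cocommutator_def commutator_def form_simps)

lemma Delta_linear: "Vector_Spaces.linear scale fscale \<Delta>"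
  and theta_linear: "Vector_Spaces.linear scale fscale \<theta>"
  and Delta_in: "\<Delta> x \<in> Tensor2"
  and theta_in: "\<theta> x \<in> Tensor2"
proof -
  show in2: "\<Delta> x \<in> Tensor2" "\<theta> x \<in> Tensor2" for x
    by (simp_all add: Delta_eq theta_eq Tensor2_closed tmap2_in r_in linear_maps)
  have fs: "fscale c t \<in> Tensor2" "pair2 (fscale c t) f g = c * pair2 t f g" if "t \<in> Tensor2" for c t f g
    using that fscale.subspace_scale[OF subspace_Tensor2] by (simp_all add: pair2_def fscale_def)
  show "Vector_Spaces.linear scale fscale \<Delta>" "Vector_Spaces.linear scale fscale \<theta>"
    by (intro linearI_vector_space vector_space_axioms vector_space_fscale Tensor2_eqI[OF finite_dim];
        simp add: in2 fs Tensor2_closed op_simps form_simps commutator_def algebra_simps)+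
qed

lemmas delta_linear = linear_cocommutator[OF theta_linear]
lemmas delta_in = cocommutator_in[OF theta_in]

lemmas form_dual_products [simp] =
  form_dual_product[OF Delta_linear] form_dual_product[OF theta_linear] form_dual_product[OF delta_linear]

text \<open>By antisymmetry \<open>h (rho (dual_product \<Delta> f g))\<close> is minus the dual
  product at \<open>rho h\<close>. Pairing \<open>YB_A mul r = 0\<close> with \<open>h\<close>,
  \<open>f\<close>, \<open>g\<close> identifies this with
  \<open>h (mul (rho f) (rho g))\<close>.\<close>

lemma rho_Delta [simp]:
  assumes "form f" "form g"
  shows "rho (dual_product \<Delta> f g) = mul (rho f) (rho g)"
proof (rule form_eqI)
  fix h assume h: "form h"
  have "h (mul (rho f) (rho g)) + f (mul (rho g) (rho h)) + g (mul (rho h) (rho f)) = 0"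
    using pair3_YB_A[OF h assms] r_YBE by (simp add: RPCA_YBE_def)
  then show "h (rho (dual_product \<Delta> f g)) = h (mul (rho f) (rho g))"
    using rho_antisym[OF form_dual_products(1) h, of f g] assms
    by (simp add: dual_product_def mul_comm[of "rho h"]) algebra
qed

text \<open>Same argument as for \<open>rho_Delta\<close>, with \<open>YB_T circ r = 0\<close>
  paired with \<open>h\<close>, \<open>f\<close>, \<open>g\<close>.\<close>

lemma rho_theta [simp]:
  assumes "form f" "form g"
  shows "rho (dual_product \<theta> f g) = circ (rho f) (rho g)"
proof (rule form_eqI)
  fix h assume h: "form h"
  have "h (circ (rho f) (rho g)) - f (circ (rho h) (rho g)) - g (br (rho h) (rho f)) = 0"
    using pair3_YB_T[OF h assms] r_YBE by (simp add: RPCA_YBE_def)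
  then show "h (rho (dual_product \<theta> f g)) = h (circ (rho f) (rho g))"
    using rho_antisym[OF form_dual_products(2) h, of f g] assms
    by (simp add: dual_product_def algebra_simps)
qed

text \<open>Antisymmetrization of \<open>rho_theta\<close>; \<open>rho\<close> is split over the
  difference only after a form \<open>h\<close> has been applied.\<close>

lemma rho_delta [simp]:
  assumes "form f" "form g"
  shows "rho (dual_product (cocommutator \<theta>) f g) = br (rho f) (rho g)"
proof (rule form_eqI)
  fix h assume h: "form h"
  have "h (rho (dual_product (cocommutator \<theta>) f g)) = h (rho (dual_product \<theta> f g)) - h (rho (dual_product \<theta> g f))"
    using assms h rho_antisym[OF form_dual_products(3) h, of f g] rho_antisym[OF form_dual_products(2) h, of f g]
      rho_antisym[OF form_dual_products(2) h, of g f]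
    by (simp add: dual_product_def cocommutator_def del: rho_theta)
  then show "h (rho (dual_product (cocommutator \<theta>) f g)) = h (br (rho f) (rho g))"
    using assms h by (simp add: commutator_def form_simps)
qed

section \<open>Normal forms, and the algebra axioms under a linear form\<close>

lemmas normal_simps = op_simps form_simps commutator_def mul_comm mul_assoc mul_left_comm

lemmas group_simps = diff_conv_add_uminus add.assoc add.commute add.left_commute

text \<open>Conditions (a)-(f) produce terms with one operator inside \<open>rho\<close> and another
  outside. Such mixed terms cancel in pairs by this rule.\<close>

lemma rho_swap:
  assumes "form f" "form g" "Vector_Spaces.linear scale scale F" "Vector_Spaces.linear scale scale G"
  shows "f (F (rho (g \<circ> G))) = - g (G (rho (f \<circ> F)))"
  using rho_antisym[of "g \<circ> G" "f \<circ> F"] assms by (simp add: form_comp)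

lemmas pair3_co_simps =
  pair3_co_left[OF Delta_in] pair3_co_left[OF theta_in] pair3_co_left[OF delta_in]
  pair3_co_right[OF Delta_in] pair3_co_right[OF theta_in] pair3_co_right[OF delta_in] dual_product_def

lemmas in_simps = fscale.subspace_0[OF subspace_Tensor2] Tensor2_closed Tensor3_closed
  tmap2_in flip2_in flip3_in rot3_in tmap3_in linear_maps Delta_in theta_in delta_in
  co_in[OF Delta_linear Delta_in] co_in[OF theta_linear theta_in] co_in[OF delta_linear delta_in]

text \<open>Each axiom is solved for one monomial, with commutators written out in
  \<open>circ\<close>, so that an instance can serve as a rewrite rule for the paired identities
  below.\<close>

lemma form_identities:
  assumes "form f"
  shows form_apl1: "f (circ x (circ y z)) = f (circ y (circ x z)) + f (circ (circ y x) z) - f (circ (circ x y) z)"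
    and form_apl2: "f (circ (circ x y) z) = f (circ (circ y x) z) - f (circ (circ y z) x) + f (circ (circ z y) x)
      - f (circ (circ z x) y) + f (circ (circ x z) y)"
    and form_leibniz: "f (circ (mul x y) z) = f (circ z (mul x y)) - f (mul (circ z x) y) + f (mul (circ x z) y)
      - f (mul x (circ z y)) + f (mul x (circ y z)) - f (mul x (mul y (P z)))"
    and form_mul_Q: "f (mul x (Q y)) = f (mul (P x) y) + f (Q (mul x y))"
    and form_circ_Q: "f (circ x (Q y)) = f (circ (P x) y) + f (Q (circ x y))"
    and form_mixed_1: "f (circ y (mul x z)) = f (mul x (circ y z)) + f (mul (circ x y) z) - f (mul (circ y x) z)
      - f (mul x (mul (P y) z))"
    and form_mixed_2: "f (circ (mul x y) z) = f (circ y (mul x z)) + f (circ x (mul y z)) - f (Q (mul x (mul y z)))"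
  using arg_cong[of _ _ f, OF anti_pre_lie_1[of x y z]] arg_cong[of _ _ f, OF anti_pre_lie_2[of x y z]]
    arg_cong[of _ _ f, OF relative_leibniz[of z x y]]
    arg_cong[of _ _ f, OF PCA_mul_Q[of x y]] arg_cong[of _ _ f, OF PCA_circ_Q[of x y]]
    arg_cong[of _ _ f, OF PCA_mixed_1[of x y z]] arg_cong[of _ _ f, OF PCA_mixed_2[of x y z]] assms
  by (simp_all add: op_simps form_simps commutator_def mul_assoc algebra_simps)

section \<open>The axioms of a relative PCA coalgebra\<close>

text \<open>Writing \<open>.\<close> for \<open>mul\<close>, both sides pair to \<open>f (x . rho g
  . rho h) + g (x . rho f . rho h) + h (x . rho f . rho g)\<close>.\<close>

lemma Delta_coassoc: "co_right \<Delta> (\<Delta> x) = co_left \<Delta> (\<Delta> x)"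
  by (rule Tensor3_eqI[OF finite_dim]) (simp_all add: in_simps pair3_co_simps normal_simps)

text \<open>These two rules loop with \<open>group_simps\<close>.\<close>

declare add_uminus_conv_diff [simp del] uminus_add_conv_diff [simp del]

lemma Delta_cocomm: "flip2 (\<Delta> x) = \<Delta> x"
  by (rule Tensor2_eqI[OF finite_dim]) (simp_all add: in_simps)

text \<open>The \<open>f\<close> and \<open>g\<close> parts come from the first anti-pre-Lie
  identity; the \<open>h\<close> part combines it with the second.\<close>

lemma theta_anti_pre_lie_1:
  "co_right \<theta> (\<theta> x) - flip3 (co_right \<theta> (\<theta> x)) = flip3 (co_left \<theta> (\<theta> x)) - co_left \<theta> (\<theta> x)"
proof (rule Tensor3_eqI[OF finite_dim]; (simp add: in_simps; fail)?)
  fix f g h assume "form f" "form g" "form h"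
  then show "pair3 (co_right \<theta> (\<theta> x) - flip3 (co_right \<theta> (\<theta> x))) f g h =
      pair3 (flip3 (co_left \<theta> (\<theta> x)) - co_left \<theta> (\<theta> x)) f g h"
    using form_apl1[of f "rho g" x "rho h"] form_apl1[of g "rho f" x "rho h"]
      form_apl1[of h "rho f" "rho g" x] form_apl1[of h "rho f" x "rho g"] form_apl1[of h "rho g" x "rho f"]
      form_apl2[of h "rho f" "rho g" x]
    by (simp add: pair3_co_simps normal_simps group_simps)
qed

text \<open>The cyclic sum puts the three forms on an equal footing: each part uses two instances of
  the first identity and one of the second.\<close>

lemma theta_anti_pre_lie_2:
  "let t = flip3 (co_left \<theta> (\<theta> x)) - co_left \<theta> (\<theta> x) in t + rot3 t + rot3 (rot3 t) = 0"
  unfolding Let_def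
proof (rule Tensor3_eqI[OF finite_dim]; (simp add: in_simps; fail)?)
  fix f g h assume "form f" "form g" "form h"
  then show "pair3 (flip3 (co_left \<theta> (\<theta> x)) - co_left \<theta> (\<theta> x)
       + rot3 (flip3 (co_left \<theta> (\<theta> x)) - co_left \<theta> (\<theta> x))
       + rot3 (rot3 (flip3 (co_left \<theta> (\<theta> x)) - co_left \<theta> (\<theta> x)))) f g h = pair3 0 f g h"
    using form_apl1[of f "rho g" x "rho h"] form_apl1[of f "rho h" x "rho g"] form_apl2[of f "rho g" "rho h" x]
      form_apl1[of g "rho f" x "rho h"] form_apl1[of g "rho h" x "rho f"] form_apl2[of g "rho f" "rho h" x]
      form_apl1[of h "rho f" x "rho g"] form_apl1[of h "rho g" x "rho f"] form_apl2[of h "rho f" "rho g" x]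
    by (simp add: pair3_co_simps normal_simps group_simps)
qed

text \<open>As \<open>rho (f \<circ> Q) = P (rho f)\<close>, each part is an instance of the axiom
  relating \<open>P\<close> and \<open>Q\<close> on \<open>mul\<close>, with second argument
  \<open>x\<close>.\<close>

lemma Delta_Q: "\<Delta> (Q x) = tmap2 Q id (\<Delta> x) + tmap2 id Q (\<Delta> x)"
  (is "?s = ?t")
proof (rule Tensor2_eqI[OF finite_dim]; (simp add: in_simps; fail)?)
  fix f g assume "form f" "form g"
  then show "pair2 ?s f g = pair2 ?t f g"
    using form_mul_Q[of f "rho g" x] form_mul_Q[of g "rho f" x]
    by (simp add: normal_simps group_simps)
qed

lemma delta_Q: "cocommutator \<theta> (Q x) =
      tmap2 Q id (cocommutator \<theta> x) + tmap2 id Q (cocommutator \<theta> x)"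
  (is "?s = ?t")
proof (rule Tensor2_eqI[OF finite_dim]; (simp add: in_simps; fail)?)
  fix f g assume "form f" "form g"
  then show "pair2 ?s f g = pair2 ?t f g"
    using form_circ_Q[of f "rho g" x] form_circ_Q[of g "rho f" x]
    by (simp add: normal_simps group_simps)
qed

text \<open>The \<open>f\<close> part is the axiom relating \<open>P\<close> and \<open>Q\<close> on
  \<open>mul\<close>; the \<open>g\<close> part is the derivation property of
  \<open>P\<close>.\<close>

lemma Delta_P: "\<Delta> (P x) = tmap2 id P (\<Delta> x) - tmap2 Q id (\<Delta> x)"
  (is "?s = ?t")
proof (rule Tensor2_eqI[OF finite_dim]; (simp add: in_simps; fail)?)
  fix f g assume "form f" "form g"
  then show "pair2 ?s f g = pair2 ?t f g"
    using form_mul_Q[of f x "rho g"]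
    by (simp add: normal_simps P_derivation_mul group_simps)
qed

lemma theta_P: "\<theta> (P x) = tmap2 id P (\<theta> x) - tmap2 Q id (\<theta> x)"
  (is "?s = ?t")
proof (rule Tensor2_eqI[OF finite_dim]; (simp add: in_simps; fail)?)
  fix f g assume "form f" "form g"
  then show "pair2 ?s f g = pair2 ?t f g"
    using form_circ_Q[of f x "rho g"]
    by (simp add: P_derivation_br form_simps group_simps)
qed

text \<open>Not only the Leibniz rule is dualized: the \<open>f\<close> part is the second mixed
  axiom, the \<open>g\<close> and \<open>h\<close> parts are the first.\<close>

lemma co_leibniz: "co_right \<Delta> (cocommutator \<theta> x) - co_left (cocommutator \<theta>) (\<Delta> x)
      - flip3 (co_right (cocommutator \<theta>) (\<Delta> x)) - tmap3 Q id id (co_left \<Delta> (\<Delta> x)) = 0"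
  (is "?s = ?t")
proof (rule Tensor3_eqI[OF finite_dim]; (simp add: in_simps; fail)?)
  fix f g h assume "form f" "form g" "form h"
  then show "pair3 ?s f g h = pair3 ?t f g h"
    using form_mixed_2[of f "rho g" "rho h" x] form_mixed_1[of g "rho f" "rho h" x]
      form_mixed_1[of h "rho f" "rho g" x]
    by (simp add: pair3_co_simps normal_simps group_simps)
qed

text \<open>The \<open>f\<close>, \<open>g\<close> and \<open>h\<close> parts are the first mixed
  axiom, the second mixed axiom and the relative Leibniz rule.\<close>

lemma co_mixed_1: "co_right \<theta> (\<Delta> x) - flip3 (co_right \<Delta> (\<theta> x))
      + co_left (cocommutator \<theta>) (\<Delta> x) - tmap3 id Q id (co_left \<Delta> (\<Delta> x)) = 0"
  (is "?s = ?t")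
proof (rule Tensor3_eqI[OF finite_dim]; (simp add: in_simps; fail)?)
  fix f g h assume "form f" "form g" "form h"
  then show "pair3 ?s f g h = pair3 ?t f g h"
    using form_mixed_1[of f "rho g" x "rho h"] form_mixed_2[of g "rho f" x "rho h"]
      form_leibniz[of h "rho f" x "rho g"]
    by (simp add: pair3_co_simps normal_simps group_simps)
qed

text \<open>The \<open>f\<close> and \<open>g\<close> parts are the first mixed axiom, the
  \<open>h\<close> part is the relative Leibniz rule.\<close>

lemma co_mixed_2: "co_left \<Delta> (\<theta> x) =
      flip3 (co_right \<Delta> (\<theta> x)) + co_right \<Delta> (\<theta> x) - co_left \<Delta> (\<Delta> (P x))"
  (is "?s = ?t")
proof (rule Tensor3_eqI[OF finite_dim]; (simp add: in_simps; fail)?)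
  fix f g h assume "form f" "form g" "form h"
  then show "pair3 ?s f g h = pair3 ?t f g h"
    using form_mixed_1[of f x "rho g" "rho h"] form_mixed_1[of g x "rho f" "rho h"]
      form_leibniz[of h "rho f" "rho g" x]
    by (simp add: pair3_co_simps normal_simps group_simps)
qed

section \<open>The compatibility conditions (a)-(f) of a bialgebra\<close>

lemma Delta_mul: "\<Delta> (mul x y) = tmap2 (mul x) id (\<Delta> y) + tmap2 id (mul y) (\<Delta> x)"
  (is "?s = ?t")
proof (rule Tensor2_eqI[OF finite_dim]; (simp add: in_simps; fail)?)
  fix f g assume "form f" "form g"
  then show "pair2 ?s f g = pair2 ?t f g"
    using rho_swap[of f g, OF _ _ linear_maps(1,1), of x y]
    by (simp add: linear_maps normal_simps group_simps)
qed

text \<open>The \<open>f\<close> part is the first anti-pre-Lie identity. The \<open>g\<close> part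
  is the Jacobi identity, obtained in terms of \<open>circ\<close> from three instances of the first
  identity and one of the second.\<close>

lemma theta_br: "\<theta> (br x y) = (tmap2 id (br x) (\<theta> y) - tmap2 (circ x) id (\<theta> y))
      - (tmap2 id (br y) (\<theta> x) - tmap2 (circ y) id (\<theta> x))"
  (is "?s = ?t")
proof (rule Tensor2_eqI[OF finite_dim]; (simp add: in_simps; fail)?)
  fix f g assume "form f" "form g"
  then show "pair2 ?s f g = pair2 ?t f g"
    using form_apl1[of g "rho f" x y] form_apl1[of g "rho f" y x] form_apl1[of g x y "rho f"]
      form_apl2[of g "rho f" x y] form_apl1[of f x y "rho g"]
      rho_swap[of f g, OF _ _ linear_maps(3,5), of y x] rho_swap[of f g, OF _ _ linear_maps(3,5), of x y]
    by (simp add: linear_maps normal_simps group_simps)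
qed

text \<open>The mixed terms \<open>f (circ y (rho (g \<circ> circ x))) + g (circ y (rho (f \<circ>
  circ x)))\<close> are symmetric in \<open>f\<close> and \<open>g\<close> and vanish under
  \<open>id - \<tau>\<close>; the other mixed terms cancel by \<open>rho_swap\<close>, and the rest
  is the first anti-pre-Lie identity.\<close>

lemma theta_circ: "let t = \<theta> (circ x y) - tmap2 (circ x) id (\<theta> y) - tmap2 id (circ x) (\<theta> y)
        + tmap2 id (\<lambda>z. circ z y) (\<theta> x)
    in t - flip2 t = 0"
  unfolding Let_def
proof (rule Tensor2_eqI[OF finite_dim]; (simp add: in_simps; fail)?)
  fix f g assume "form f" "form g"
  then show "pair2 ((\<theta> (circ x y) - tmap2 (circ x) id (\<theta> y) - tmap2 id (circ x) (\<theta> y)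
        + tmap2 id (\<lambda>z. circ z y) (\<theta> x))
      - flip2 (\<theta> (circ x y) - tmap2 (circ x) id (\<theta> y) - tmap2 id (circ x) (\<theta> y)
        + tmap2 id (\<lambda>z. circ z y) (\<theta> x))) f g = pair2 0 f g"
    using form_apl1[of f "rho g" x y] form_apl1[of g "rho f" x y]
      rho_swap[of f g, OF _ _ linear_maps(4,3), of x y] rho_swap[of g f, OF _ _ linear_maps(4,3), of x y]
    by (simp add: linear_maps normal_simps group_simps)
qed

text \<open>Apart from mixed terms, the \<open>f\<close> part is the second mixed axiom and the
  \<open>g\<close> part the relative Leibniz rule.\<close>

lemma theta_mul: "\<theta> (mul x y) + tmap2 (circ y) id (\<Delta> x) - tmap2 id (mul x) (\<theta> y)
      + tmap2 (circ x) id (\<Delta> y) - tmap2 id (mul y) (\<theta> x) - tmap2 Q id (\<Delta> (mul x y)) = 0"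
  (is "?s = ?t")
proof (rule Tensor2_eqI[OF finite_dim]; (simp add: in_simps; fail)?)
  fix f g assume "form f" "form g"
  then show "pair2 ?s f g = pair2 ?t f g"
    using form_mixed_2[of f x y "rho g"] form_leibniz[of g x y "rho f"]
      rho_swap[of f g, OF _ _ linear_maps(3,1), of x y] rho_swap[of f g, OF _ _ linear_maps(3,1), of y x]
    by (simp add: linear_maps normal_simps group_simps)
qed

text \<open>The condition is symmetric under \<tau>, so both parts are the first mixed
  axiom.\<close>

lemma Delta_circ: "\<Delta> (circ x y) + (flip2 (tmap2 id (mul y) (\<theta> x)) + tmap2 id (mul y) (\<theta> x))
      - (tmap2 id (circ x) (\<Delta> y) + tmap2 (circ x) id (\<Delta> y)) - \<Delta> (mul (P x) y) = 0"
  (is "?s = ?t")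
proof (rule Tensor2_eqI[OF finite_dim]; (simp add: in_simps; fail)?)
  fix f g assume "form f" "form g"
  then show "pair2 ?s f g = pair2 ?t f g"
    using form_mixed_1[of g x "rho f" y] form_mixed_1[of f x "rho g" y]
      rho_swap[of f g, OF _ _ linear_maps(3,1), of x y] rho_swap[of g f, OF _ _ linear_maps(3,1), of x y]
    by (simp add: linear_maps normal_simps group_simps)
qed

text \<open>The \<open>f\<close> part is the first mixed axiom, the \<open>g\<close> part the
  relative Leibniz rule.\<close>

lemma Delta_br: "(tmap2 (mul x) id (\<theta> y) - tmap2 id (mul x) (\<theta> y))
      + (tmap2 (circ y) id (\<Delta> x) - tmap2 id (br y) (\<Delta> x))
      - \<Delta> (br x y) + \<Delta> (mul x (P y)) = 0"
  (is "?s = ?t")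
proof (rule Tensor2_eqI[OF finite_dim]; (simp add: in_simps; fail)?)
  fix f g assume "form f" "form g"
  then show "pair2 ?s f g = pair2 ?t f g"
    using form_leibniz[of g "rho f" x y] form_mixed_1[of f y x "rho g"]
      rho_swap[of f g, OF _ _ linear_maps(3,1), of y x] rho_swap[of f g, OF _ _ linear_maps(1,5), of x y]
    by (simp add: linear_maps normal_simps group_simps)
qed

text \<open>The \<open>f\<close> part is the first mixed axiom, the \<open>g\<close> part the
  second.\<close>

lemma delta_mul: "tmap2 id (\<lambda>z. circ z y) (\<Delta> x) + tmap2 (mul x) id (cocommutator \<theta> y)
      - tmap2 id (circ x) (\<Delta> y) + flip2 (tmap2 id (mul y) (\<theta> x))
      - cocommutator \<theta> (mul x y) + tmap2 id Q (\<Delta> (mul x y)) = 0"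
  (is "?s = ?t")
proof (rule Tensor2_eqI[OF finite_dim]; (simp add: in_simps; fail)?)
  fix f g assume "form f" "form g"
  then show "pair2 ?s f g = pair2 ?t f g"
    using form_mixed_2[of g "rho f" x y] form_mixed_1[of f "rho g" x y]
      rho_swap[of f g, OF _ _ linear_maps(1,4), of x y] rho_swap[of f g, OF _ _ linear_maps(1,3), of y x]
    by (simp add: linear_maps normal_simps group_simps)
qed

section \<open>Assembly of the bialgebra\<close>

lemma bialgebra: "relative_PCA_bialgebra scale mul circ \<Delta> \<theta> P Q"
proof (intro relative_PCA_bialgebra.intro relative_PCA_coalgebra.intro)
  show "relative_PCA_algebra scale mul circ P Q"
    by (rule relative_PCA_algebra_axioms)
  show "cocomm_coassoc_coalgebra scale \<Delta>"
    by (intro cocomm_coassoc_coalgebra.intro cocomm_coassoc_coalgebra_axioms.intro tensor_powers_axioms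
        Delta_linear Delta_in Delta_cocomm Delta_coassoc)
  show "anti_pre_lie_coalgebra scale \<theta>"
    by (intro anti_pre_lie_coalgebra.intro anti_pre_lie_coalgebra_axioms.intro tensor_powers_axioms
        theta_linear theta_in theta_anti_pre_lie_1 theta_anti_pre_lie_2)
  show "relative_PCA_coalgebra_axioms scale \<Delta> \<theta> Q P"
    by (intro relative_PCA_coalgebra_axioms.intro Q_linear P_linear Delta_Q delta_Q co_leibniz
        Delta_P theta_P co_mixed_1 co_mixed_2)
  show "relative_PCA_bialgebra_axioms scale mul circ \<Delta> \<theta> P Q"
    by (intro relative_PCA_bialgebra_axioms.intro Delta_mul theta_circ theta_br theta_mul Delta_circ
        Delta_br delta_mul)
qed

end

theorem corollary4p7:
  fixes scale :: "'k::{alg_closed_field, field_char_0} \<Rightarrow> 'a::ab_group_add \<Rightarrow> 'a"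
    and Basis :: "'a set"
    and mul circ :: "'a \<Rightarrow> 'a \<Rightarrow> 'a"
    and P Q :: "'a \<Rightarrow> 'a"
    and r :: "('a, 'k) tensor2"
    and \<Delta> \<theta> :: "'a \<Rightarrow> ('a, 'k) tensor2"
  assumes "finite_dimensional_vector_space scale Basis"
    and "relative_PCA_algebra scale mul circ P Q"
    and "r \<in> tensor_powers.Tensor2 scale"
    and "tensor_powers.antisymmetric_tensor scale r"
    and "tensor_powers.RPCA_YBE scale mul circ P Q r"
    and "\<And>x. \<Delta> x = tensor_powers.tmap2 scale id (mul x) r - tensor_powers.tmap2 scale (mul x) id r"
    and "\<And>x. \<theta> x = tensor_powers.tmap2 scale (circ x) id r
      - tensor_powers.tmap2 scale id (commutator circ x) r"
  shows "relative_PCA_bialgebra scale mul circ \<Delta> \<theta> P Q"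
proof -
  have "tensor_powers scale"
    using assms(1) by (simp add: tensor_powers_def finite_dimensional_vector_space_def)
  then have "RPCA_YBE_solution scale mul circ P Q Basis r \<Delta> \<theta>"
    by (intro RPCA_YBE_solution.intro RPCA_YBE_solution_axioms.intro assms)
  then show ?thesis
    by (rule RPCA_YBE_solution.bialgebra)
qed

end
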